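(* Let $V=(V_t)_{t\in[0,\tau]}$ be a BMO process and let $r$ be a fixed number in $[0,\tau]$. Then $$\Big\|\mathbb E_r\sup_{r\le t\le \tau}|V_t-V_r|^p\Big\|_\infty\le p!\,(11\,\rho_{r,\tau}(V))^p\quad\text{for every integer }p\ge1,$$ and $$\mathbb E_r\, e^{\lambda\sup_{r\le t\le \tau}|V_t-V_r|}<\infty\ \text{ (a.s.)}\quad\text{for every }\lambda<(11\,\kappa_{r,\tau}(V))^{-1}.$$
   Context: Fix $\tau>0$ and a probability space $(\Omega,\mathcal G,\mathbb P)$ with a filtration $\{\mathcal F_t\}_{t\ge0}$ satisfying the usual conditions. For a stopping time $S$, $\mathbb E_S$ denotes conditional expectation given $\mathcal F_S$; $\|\cdot\|_m$ is the norm of $L^m(\Omega,\mathcal G,\mathbb P)$, $m\in[1,\infty]$. For an RCLL process, $V_{s-}=\lim_{r\uparrow s}V_r$ and $V_{0-}:=V_0$. A real-valued adapted RCLL process $(V_t)_{t\in[0,\tau]}$ is BMO if $[V]_{\mathrm{BMO}}:=\sup_{0\le S\le T\le\tau}\|\mathbb E_S|V_T-V_{S-}|\|_\infty<\infty$, the supremum being over all stopping times $S,T$ with $0\le S\le T\le\tau$. For a BMO process $V$ and $0\le s\le t\le\tau$, the modulus of mean oscillation is $\rho_{s,t}(V)=\sup_{s\le S\le T\le t}\|\mathbb E_S|V_T-V_{S-}|\|_\infty$ (supremum over stopping times $S,T$ with $s\le S\le T\le t$), and $\kappa_{s,t}(V)=\lim_{h\downarrow0}\sup_{s\le u\le v\le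 t,\ v-u\le h}\rho_{u,v}(V)$. Convention: $(11\kappa_{r,\tau}(V))^{-1}=+\infty$ when $\kappa_{r,\tau}(V)=0$. *)

theory Defs
  imports "HOL-Probability.Probability"
begin

text \<open>
  Time is indexed by \<^typ>\<open>real\<close>; the sigma-algebras at negative times play no role: a random
  time that is nonnegative on the sample space satisfies \<^const>\<open>stopping_time\<close> iff the
  defining condition holds for all \<open>t \<ge> 0\<close>, and likewise for membership of a set in its
  \<open>pre_sigma\<close> algebra.  Every filtration on \<open>[0,\<infinity>)\<close> extends to negative times by \<open>F 0\<close>.
\<close>

locale usual_filtered_prob_space =
  prob_space M + complete_measure M + filtration "space M" F
  for M :: "'a measure" and F :: "real \<Rightarrow> 'a measure" +
  assumes sets_F_subset: "\<And>t. sets (F t) \<subseteq> sets M"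
    and null_sets_subset_F0: "null_sets M \<subseteq> sets (F 0)"
    and F_right_continuous: "\<And>t. 0 \<le> t \<Longrightarrow> sets (F t) = (\<Inter>s\<in>{t<..}. sets (F s))"

definition adapted_on :: "(real \<Rightarrow> 'a measure) \<Rightarrow> real \<Rightarrow> (real \<Rightarrow> 'a \<Rightarrow> real) \<Rightarrow> bool"
  where "adapted_on F \<tau> V \<longleftrightarrow> (\<forall>t\<in>{0..\<tau>}. V t \<in> borel_measurable (F t))"

definition rcll_on :: "real \<Rightarrow> (real \<Rightarrow> real) \<Rightarrow> bool"
  where "rcll_on \<tau> v \<longleftrightarrow>
    (\<forall>t\<in>{0..<\<tau>}. continuous (at_right t) v) \<and>
    (\<forall>t\<in>{0<..\<tau>}. \<exists>l. (v \<longlongrightarrow> l) (at_left t))"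

definition left_lim :: "(real \<Rightarrow> 'a \<Rightarrow> real) \<Rightarrow> real \<Rightarrow> 'a \<Rightarrow> real"
  where "left_lim V s \<omega> = (if s = 0 then V 0 \<omega> else Lim (at_left s) (\<lambda>u. V u \<omega>))"

text \<open>
  The value \<open>\<parallel>E\<^sub>S |V\<^sub>T - V\<^sub>S\<^sub>-| \<parallel>\<^sub>\<infinity>\<close> in \<open>[0,\<infinity>]\<close>.  For nonnegative functions the norm of
  \<open>L\<^sup>\<infinity>\<close> is the essential supremum, and \<^const>\<open>nn_cond_exp\<close> requires no integrability;
  it requires measurability of the argument, which holds when \<open>V\<close> is adapted with RCLL paths.
\<close>

definition mean_osc ::
  "'a measure \<Rightarrow> (real \<Rightarrow> 'a measure) \<Rightarrow> (real \<Rightarrow> 'a \<Rightarrow> real) \<Rightarrow> ('a \<Rightarrow> real) \<Rightarrow> ('a \<Rightarrow> real) \<Rightarrow> ennreal"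
  where "mean_osc M F V S T =
    esssup M (nn_cond_exp M (filtration.pre_sigma (space M) F S)
      (\<lambda>\<omega>. ennreal \<bar>V (T \<omega>) \<omega> - left_lim V (S \<omega>) \<omega>\<bar>))"

definition stopping_pairs ::
  "'a measure \<Rightarrow> (real \<Rightarrow> 'a measure) \<Rightarrow> real \<Rightarrow> real \<Rightarrow> (('a \<Rightarrow> real) \<times> ('a \<Rightarrow> real)) set"
  where "stopping_pairs M F s t =
    {(S, T). stopping_time F S \<and> stopping_time F T \<and>
       (\<forall>\<omega>\<in>space M. s \<le> S \<omega> \<and> S \<omega> \<le> T \<omega> \<and> T \<omega> \<le> t)}"

definition bmo_seminorm ::
  "'a measure \<Rightarrow> (real \<Rightarrow> 'a measure) \<Rightarrow> real \<Rightarrow> (real \<Rightarrow> 'a \<Rightarrow> real) \<Rightarrow> ennreal"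
  where "bmo_seminorm M F \<tau> V = (SUP (S, T)\<in>stopping_pairs M F 0 \<tau>. mean_osc M F V S T)"

definition bmo_process ::
  "'a measure \<Rightarrow> (real \<Rightarrow> 'a measure) \<Rightarrow> real \<Rightarrow> (real \<Rightarrow> 'a \<Rightarrow> real) \<Rightarrow> bool"
  where "bmo_process M F \<tau> V \<longleftrightarrow>
    adapted_on F \<tau> V \<and> (\<forall>\<omega>\<in>space M. rcll_on \<tau> (\<lambda>t. V t \<omega>)) \<and> bmo_seminorm M F \<tau> V < \<infinity>"

definition osc_modulus ::
  "'a measure \<Rightarrow> (real \<Rightarrow> 'a measure) \<Rightarrow> (real \<Rightarrow> 'a \<Rightarrow> real) \<Rightarrow> real \<Rightarrow> real \<Rightarrow> ennreal"
  where "osc_modulus M F V s t = (SUP (S, T)\<in>stopping_pairs M F s t. mean_osc M F V S T)"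

text \<open>The limit exists in \<open>[0,\<infinity>]\<close>, since the supremum is monotone in \<open>h\<close>.\<close>

definition osc_kappa ::
  "'a measure \<Rightarrow> (real \<Rightarrow> 'a measure) \<Rightarrow> (real \<Rightarrow> 'a \<Rightarrow> real) \<Rightarrow> real \<Rightarrow> real \<Rightarrow> ennreal"
  where "osc_kappa M F V s t =
    Lim (at_right 0) (\<lambda>h. SUP (u, v)\<in>{(u, v). s \<le> u \<and> u \<le> v \<and> v \<le> t \<and> v - u \<le> h}.
      osc_modulus M F V u v)"

end

theory Submission
  imports Defs
begin

text \<open>
  Taking \<open>S = T\<close> in the definition of \<open>\<rho> = \<rho>\<^bsub>u,v\<^esub>(V)\<close> bounds every jump of \<open>V\<close> at a stopping time by
  \<open>\<rho>\<close>, hence \<open>E\<^sub>S \<bar>V\<^sub>T - V\<^sub>S\<bar> \<le> 2\<rho>\<close>.  Starting at \<open>u\<close>, stop successively whenever \<open>V\<close> has moved by more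
  than \<open>4\<rho>\<close> since the previous stop.  By Markov's inequality each further stop before \<open>v\<close> has
  conditional probability at most \<open>1/2\<close>, while between consecutive stops, jump included, the path
  moves by at most \<open>5\<rho>\<close>.  Therefore \<open>P\<^sub>u(sup \<bar>V\<^sub>t - V\<^sub>u\<bar> > 5\<rho>n) \<le> 2\<^sup>-\<^sup>n\<close>, and comparison with the rising
  factorial moments of the geometric distribution gives the moments with constant \<open>10\<close> in place of
  \<open>11\<close>.  Summing them bounds the exponential moment on intervals so short that \<open>10\<lambda>\<rho> < 1\<close>; finitely
  many such intervals are chained by conditioning.
\<close>

subsection \<open>Right continuous functions with left limits\<close>

lemma rcll_on_right_tendsto:
  assumes "rcll_on \<tau> v" "0 \<le> t" "t < \<tau>"
  shows "(v \<longlongrightarrow> v t) (at_right t)"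
  using assms by (auto simp: rcll_on_def continuous_within)

lemma rcll_on_left_tendsto:
  assumes "rcll_on \<tau> v" "0 < t" "t \<le> \<tau>"
  shows "(v \<longlongrightarrow> Lim (at_left t) v) (at_left t)"
proof -
  obtain l where "(v \<longlongrightarrow> l) (at_left t)"
    using assms by (fastforce simp: rcll_on_def)
  then show ?thesis
    using tendsto_Lim[of "at_left t" v l] by simp
qed

text \<open>One-sided limits bound the path near every point, and bisection of
  \<open>{0..\<tau>}\<close> makes the bound global. Hence the suprema over uncountably many times
  are genuine real suprema.\<close>

lemma rcll_on_bounded:
  fixes v :: "real \<Rightarrow> real"
  assumes v: "rcll_on \<tau> v"
  shows "\<exists>B. \<forall>t\<in>{0..\<tau>}. \<bar>v t\<bar> \<le> B"
proof (cases "0 \<le> \<tau>")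
  case True
  have near: "\<exists>d>0. \<exists>B. \<forall>t\<in>{0..\<tau>}. \<bar>t - x\<bar> < d \<longrightarrow> \<bar>v t\<bar> \<le> B" if x: "0 \<le> x" "x \<le> \<tau>" for x
  proof -
    have "\<exists>B d. 0 < d \<and> (\<forall>t\<in>{0..\<tau>}. x < t \<and> t < x + d \<longrightarrow> \<bar>v t\<bar> \<le> B)"
    proof (cases "x < \<tau>")
      case True
      have "\<forall>\<^sub>F t in at_right x. dist (v t) (v x) < 1"
        using rcll_on_right_tendsto[OF v x(1) True] by (rule tendstoD) simp
      then obtain b where b: "b > x" "\<And>y. x < y \<Longrightarrow> y < b \<Longrightarrow> dist (v y) (v x) < 1"
        unfolding eventually_at_right_field by blast
      have "\<bar>v y\<bar> \<le> \<bar>v x\<bar> + 1" if "x < y" "y < x + (b - x)" for y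
        using b(2)[of y] that by (auto simp: dist_real_def)
      then show ?thesis using b(1) by (intro exI[of _ "\<bar>v x\<bar> + 1"] exI[of _ "b - x"]) auto
    next
      case False
      then show ?thesis using x by (intro exI[of _ 0] exI[of _ 1]) auto
    qed
    then obtain B1 d1 where 1: "0 < d1" "\<And>t. t\<in>{0..\<tau>} \<Longrightarrow> x < t \<Longrightarrow> t < x + d1 \<Longrightarrow> \<bar>v t\<bar> \<le> B1"
      by blast
    have "\<exists>B d. 0 < d \<and> (\<forall>t\<in>{0..\<tau>}. x - d < t \<and> t < x \<longrightarrow> \<bar>v t\<bar> \<le> B)"
    proof (cases "0 < x")
      case True
      let ?l = "Lim (at_left x) v"
      have "\<forall>\<^sub>F t in at_left x. dist (v t) ?l < 1"
        using rcll_on_left_tendsto[OF v True x(2)] by (rule tendstoD) simp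
      then obtain b where b: "b < x" "\<And>y. b < y \<Longrightarrow> y < x \<Longrightarrow> dist (v y) ?l < 1"
        unfolding eventually_at_left_field by blast
      have "\<bar>v y\<bar> \<le> \<bar>?l\<bar> + 1" if "y < x" "x - (x - b) < y" for y
        using b(2)[of y] that by (auto simp: dist_real_def)
      then show ?thesis using b(1) by (intro exI[of _ "\<bar>?l\<bar> + 1"] exI[of _ "x - b"]) auto
    next
      case False
      then show ?thesis using x by (intro exI[of _ 0] exI[of _ 1]) auto
    qed
    then obtain B2 d2 where 2: "0 < d2" "\<And>t. t\<in>{0..\<tau>} \<Longrightarrow> x - d2 < t \<Longrightarrow> t < x \<Longrightarrow> \<bar>v t\<bar> \<le> B2"
      by blast
    have "\<bar>v t\<bar> \<le> max \<bar>v x\<bar> (max B1 B2)" if "t \<in> {0..\<tau>}" "\<bar>t - x\<bar> < min d1 d2" for t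
      using 1(2)[of t] 2(2)[of t] that by (cases t x rule: linorder_cases) auto
    then show ?thesis
      using 1(1) 2(1) by (intro exI[of _ "min d1 d2"] conjI exI[of _ "max \<bar>v x\<bar> (max B1 B2)"]) simp_all
  qed
  have "\<exists>B. \<forall>t\<in>{0..\<tau>} \<inter> {0..\<tau>}. \<bar>v t\<bar> \<le> B"
  \<comment> \<open>Bisection also asks about intervals that stick out of
    \<open>{0..\<tau>}\<close>, hence the intersection.\<close>
  proof (rule Bolzano[OF True, of "\<lambda>a b. \<exists>B. \<forall>t\<in>{a..b} \<inter> {0..\<tau>}. \<bar>v t\<bar> \<le> B"])
    fix a b c assume "\<exists>B. \<forall>t\<in>{a..b} \<inter> {0..\<tau>}. \<bar>v t\<bar> \<le> B" "\<exists>B. \<forall>t\<in>{b..c} \<inter> {0..\<tau>}. \<bar>v t\<bar> \<le> B"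
    then obtain B1 B2 where B: "\<And>t. t \<in> {a..b} \<inter> {0..\<tau>} \<Longrightarrow> \<bar>v t\<bar> \<le> B1"
      "\<And>t. t \<in> {b..c} \<inter> {0..\<tau>} \<Longrightarrow> \<bar>v t\<bar> \<le> B2"
      by blast
    have "\<bar>v t\<bar> \<le> max B1 B2" if "t \<in> {a..c} \<inter> {0..\<tau>}" for t
      using B[of t] that by (cases "t \<le> b") auto
    then show "\<exists>B. \<forall>t\<in>{a..c} \<inter> {0..\<tau>}. \<bar>v t\<bar> \<le> B"
      by blast
  next
    fix x assume "0 \<le> x" "x \<le> \<tau>"
    from near[OF this] obtain d B where d: "d > 0"
      and B: "\<And>t. t\<in>{0..\<tau>} \<Longrightarrow> \<bar>t - x\<bar> < d \<Longrightarrow> \<bar>v t\<bar> \<le> B" by blast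
    have "\<exists>B. \<forall>t\<in>{a..b} \<inter> {0..\<tau>}. \<bar>v t\<bar> \<le> B" if "a \<le> x \<and> x \<le> b \<and> b - a < d" for a b
      using that by (intro exI[of _ B] ballI B) auto
    then show "\<exists>d>0. \<forall>a b. a \<le> x \<and> x \<le> b \<and> b - a < d \<longrightarrow> (\<exists>B. \<forall>t\<in>{a..b} \<inter> {0..\<tau>}. \<bar>v t\<bar> \<le> B)"
      using d by blast
  qed
  then show ?thesis by simp
qed auto

text \<open>By right continuity a strict inequality at \<open>x\<close> persists just after
  \<open>x\<close>, where rational times exist. This replaces uncountable unions over times by
  countable ones.\<close>

lemma rcll_on_rational_witness:
  fixes v :: "real \<Rightarrow> real"
  assumes v: "rcll_on \<tau> v" and "0 \<le> x" "x < t" "t \<le> \<tau>" and y: "y < \<bar>v x - c\<bar>"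
  obtains q where "q \<in> \<rat>" "x < q" "q < t" "y < \<bar>v q - c\<bar>"
proof -
  have "((\<lambda>s. \<bar>v s - c\<bar>) \<longlongrightarrow> \<bar>v x - c\<bar>) (at_right x)"
    using assms by (intro tendsto_intros rcll_on_right_tendsto[OF v]) auto
  then have "\<forall>\<^sub>F s in at_right x. y < \<bar>v s - c\<bar>"
    using y by (rule order_tendstoD)
  then obtain b where b: "b > x" "\<And>s. x < s \<Longrightarrow> s < b \<Longrightarrow> y < \<bar>v s - c\<bar>"
    unfolding eventually_at_right_field by blast
  obtain q where "q \<in> \<rat>" "x < q" "q < min b t"
    using Rats_dense_in_real[of x "min b t"] b(1) assms by auto
  then show ?thesis using b(2)[of q] that by auto
qed

subsection \<open>Bounds on conditional expectations\<close>

text \<open>Under an \<open>F\<close>-measurable weight, \<open>f\<close> may be replaced by its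
  conditional expectation. Together with its converse \<open>nn_cond_exp_leI\<close>, this lets
  conditional estimates be carried out as integral inequalities.\<close>

lemma (in sigma_finite_subalgebra) nn_integral_mult_le_of_nn_cond_exp_le:
  assumes [measurable]: "g \<in> borel_measurable F" "f \<in> borel_measurable M"
    and le: "AE x in M. nn_cond_exp M F f x \<le> C"
  shows "(\<integral>\<^sup>+x. g x * f x \<partial>M) \<le> C * (\<integral>\<^sup>+x. g x \<partial>M)"
proof -
  have [measurable]: "g \<in> borel_measurable M"
    by (rule measurable_from_subalg[OF subalg]) simp
  have "(\<integral>\<^sup>+x. g x * f x \<partial>M) = (\<integral>\<^sup>+x. g x * nn_cond_exp M F f x \<partial>M)"
    by (simp add: nn_cond_exp_intg)
  also have "\<dots> \<le> (\<integral>\<^sup>+x. C * g x \<partial>M)"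
  proof (rule nn_integral_mono_AE)
    show "AE x in M. g x * nn_cond_exp M F f x \<le> C * g x"
      using le by eventually_elim (simp add: mult.commute[of C] mult_left_mono)
  qed
  finally show ?thesis by (simp add: nn_integral_cmult)
qed

text \<open>Testing the integral bound on the set where the conditional expectation exceeds
  \<open>C\<close> shows that this set is null.\<close>

lemma (in sigma_finite_subalgebra) nn_cond_exp_leI:
  assumes [measurable]: "f \<in> borel_measurable M" and C: "C < \<infinity>" and fin: "finite_measure M"
    and le: "\<And>A. A \<in> sets F \<Longrightarrow> (\<integral>\<^sup>+x\<in>A. f x \<partial>M) \<le> C * emeasure M A"
  shows "AE x in M. nn_cond_exp M F f x \<le> C"
proof -
  define g where "g = nn_cond_exp M F f"
  have [measurable]: "g \<in> borel_measurable F" "g \<in> borel_measurable M"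
    by (simp_all add: g_def)
  define A where "A = {x \<in> space F. C < g x}"
  have A[measurable]: "A \<in> sets F" unfolding A_def by measurable
  have AM[measurable]: "A \<in> sets M" using A subalg by (auto simp: subalgebra_def)
  have "emeasure M A < \<infinity>"
    using finite_measure.emeasure_finite[OF fin, of A] by (simp add: less_top)
  then have fin_A: "C * emeasure M A < \<infinity>" using C by (simp add: ennreal_mult_less_top)
  have "(\<integral>\<^sup>+x. g x * indicator A x \<partial>M) = (\<integral>\<^sup>+x. indicator A x * f x \<partial>M)"
    unfolding g_def by (subst nn_cond_exp_intg[symmetric]) (simp_all add: mult.commute)
  also have "\<dots> \<le> C * emeasure M A" using le[OF A] by (simp add: mult.commute)
  finally have *: "(\<integral>\<^sup>+x. g x * indicator A x \<partial>M) \<le> C * emeasure M A" .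
  \<comment> \<open>Finiteness of \<open>C * emeasure M A\<close> makes the subtraction legitimate
    in the extended nonnegative reals.\<close>
  have "(\<integral>\<^sup>+x. g x * indicator A x - C * indicator A x \<partial>M)
      = (\<integral>\<^sup>+x. g x * indicator A x \<partial>M) - (\<integral>\<^sup>+x. C * indicator A x \<partial>M)"
  proof (rule nn_integral_diff)
    show "(\<integral>\<^sup>+x. C * indicator A x \<partial>M) \<noteq> \<infinity>"
      using fin_A by (simp add: nn_integral_cmult)
    show "AE x in M. C * indicator A x \<le> g x * indicator A x"
      by (rule AE_I2) (auto simp: A_def indicator_def)
  qed measurable
  also have "\<dots> = 0"
    using * le_less_trans[OF * fin_A] by (simp add: nn_integral_cmult diff_eq_0_ennreal)
  finally have "AE x in M. g x * indicator A x - C * indicator A x = 0"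
    by (subst (asm) nn_integral_0_iff_AE) auto
  then show ?thesis
    unfolding g_def[symmetric]
    using AE_space
  proof eventually_elim
    case (elim x)
    then show ?case
      using subalg
      by (cases "x \<in> A") (auto simp: A_def subalgebra_def diff_eq_0_iff_ennreal not_less)
  qed
qed

subsection \<open>Processes evaluated at random times\<close>

locale rcll_process = usual_filtered_prob_space M F
  for M :: "'a measure" and F :: "real \<Rightarrow> 'a measure" +
  fixes V :: "real \<Rightarrow> 'a \<Rightarrow> real" and \<tau> :: real
  assumes adapted: "adapted_on F \<tau> V"
    and rcll: "\<And>\<omega>. \<omega> \<in> space M \<Longrightarrow> rcll_on \<tau> (\<lambda>t. V t \<omega>)"
begin

lemma measurable_V: "0 \<le> s \<Longrightarrow> s \<le> q \<Longrightarrow> q \<le> \<tau> \<Longrightarrow> V s \<in> borel_measurable (F q)"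
  using adapted sets_F_mono[of s q]
  by (auto simp: adapted_on_def space_F intro!: borel_measurable_subalgebra[of "F s" "F q"])

text \<open>A form of progressive measurability: \<open>U\<close> is approximated from the right by
  random times with countably many values, which reduces the claim to fixed times, and right
  continuity passes to the limit.\<close>

lemma measurable_V_random_time:
  assumes q: "0 \<le> q" "q \<le> \<tau>" and U[measurable]: "U \<in> borel_measurable (F q)"
    and U_le: "\<And>\<omega>. \<omega> \<in> space M \<Longrightarrow> 0 \<le> U \<omega> \<and> U \<omega> \<le> q"
  shows "(\<lambda>\<omega>. V (U \<omega>) \<omega>) \<in> borel_measurable (F q)"
proof (rule borel_measurable_LIMSEQ_real)
  let ?g = "\<lambda>n \<omega>. \<lfloor>real (Suc n) * U \<omega>\<rfloor>"
  \<comment> \<open>The \<open>+ 1\<close> puts the grid point strictly to the right of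
    \<open>U \<omega>\<close>; capping at \<open>q\<close> keeps it within the scope of
    \<open>F q\<close> and returns \<open>q\<close> itself when \<open>U \<omega> = q\<close>. With
    \<open>max 0\<close> every integer, attained or not, yields a time in
    \<open>{0..q}\<close>.\<close>
  let ?U = "\<lambda>n \<omega>. max 0 (min q ((of_int (?g n \<omega>) + 1) / real (Suc n)))"
  show "(\<lambda>\<omega>. V (?U n \<omega>) \<omega>) \<in> borel_measurable (F q)" for n
  proof (rule measurable_compose_countable
      [of "\<lambda>k. V (max 0 (min q ((of_int k + 1) / real (Suc n))))" _ _ "?g n"])
    show "V (max 0 (min q ((of_int k + 1) / real (Suc n)))) \<in> borel_measurable (F q)" for k :: int
      using q by (intro measurable_V) auto
    show "?g n \<in> measurable (F q) (count_space UNIV)" by measurable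
  qed
  fix \<omega> assume "\<omega> \<in> space (F q)"
  then have \<omega>: "\<omega> \<in> space M" by (simp add: space_F)
  note Ul = U_le[OF \<omega>]
  have lower: "U \<omega> < (of_int (?g n \<omega>) + 1) / real (Suc n)" for n
    using floor_correct[of "real (Suc n) * U \<omega>"] by (simp add: field_simps del: of_nat_Suc)
  have upper: "(of_int (?g n \<omega>) + 1) / real (Suc n) \<le> U \<omega> + 1 / real (Suc n)" for n
    using of_int_floor_le[of "real (Suc n) * U \<omega>"] by (simp add: field_simps del: of_nat_Suc)
  show "(\<lambda>n. V (?U n \<omega>) \<omega>) \<longlonglongrightarrow> V (U \<omega>) \<omega>"
  proof (cases "U \<omega> = q")
    case True
    have "?U n \<omega> = q" for n using lower[of n] True q by auto
    then show ?thesis using True by simp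
  next
    case False
    then have lt: "U \<omega> < q" using Ul by auto
    have gt: "U \<omega> < ?U n \<omega>" for n using lower[of n] lt by auto
    have le: "?U n \<omega> \<le> U \<omega> + 1 / real (Suc n)" for n
    proof -
      have "0 \<le> U \<omega> + 1 / real (Suc n)" using Ul by simp
      then show ?thesis using upper[of n] by linarith
    qed
    define W where "W n = ?U n \<omega>" for n
    have gt: "U \<omega> < W n" and le: "W n \<le> U \<omega> + 1 / real (Suc n)" for n
      unfolding W_def by (fact gt, fact le)
    have "(\<lambda>n. U \<omega> + 1 / real (Suc n)) \<longlonglongrightarrow> U \<omega> + 0"
      using LIMSEQ_inverse_real_of_nat by (intro tendsto_intros) (simp add: inverse_eq_divide)
    then have "(\<lambda>n. U \<omega> + 1 / real (Suc n)) \<longlonglongrightarrow> U \<omega>"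
      by simp
    then have "W \<longlonglongrightarrow> U \<omega>"
      by (intro tendsto_sandwich[of "\<lambda>_. U \<omega>" W _ "\<lambda>n. U \<omega> + 1 / real (Suc n)"]
          always_eventually allI le less_imp_le[OF gt] tendsto_const)
    then have "filterlim W (at_right (U \<omega>)) sequentially"
      unfolding filterlim_at using gt by (auto simp: less_imp_neq[THEN not_sym])
    moreover have "((\<lambda>t. V t \<omega>) \<longlongrightarrow> V (U \<omega>) \<omega>) (at_right (U \<omega>))"
      using Ul lt q by (intro rcll_on_right_tendsto[OF rcll[OF \<omega>]]) auto
    ultimately show ?thesis unfolding W_def[symmetric] by (rule filterlim_compose[rotated])
  qed
qed

text \<open>Approximation from the left by \<open>U \<omega> - 1 / (n + 1)\<close> reduces this to
  the preceding lemma. At \<open>U \<omega> = 0\<close> the truncated times are all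
  \<open>0\<close>, in agreement with the convention in \<open>left_lim\<close>.\<close>

lemma measurable_left_lim_random_time:
  assumes q: "0 \<le> q" "q \<le> \<tau>" and U[measurable]: "U \<in> borel_measurable (F q)"
    and U_le: "\<And>\<omega>. \<omega> \<in> space M \<Longrightarrow> 0 \<le> U \<omega> \<and> U \<omega> \<le> q"
  shows "(\<lambda>\<omega>. left_lim V (U \<omega>) \<omega>) \<in> borel_measurable (F q)"
proof (rule borel_measurable_LIMSEQ_real)
  let ?U = "\<lambda>n \<omega>. max 0 (U \<omega> - 1 / real (Suc n))"
  show "(\<lambda>\<omega>. V (?U n \<omega>) \<omega>) \<in> borel_measurable (F q)" for n
  proof (rule measurable_V_random_time[OF q])
    show "?U n \<in> borel_measurable (F q)" by measurable
    have "0 \<le> 1 / real (Suc n)" by simp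
    then show "0 \<le> ?U n \<omega> \<and> ?U n \<omega> \<le> q" if "\<omega> \<in> space M" for \<omega>
      using U_le[OF that] by linarith
  qed
  fix \<omega> assume "\<omega> \<in> space (F q)"
  then have \<omega>: "\<omega> \<in> space M" by (simp add: space_F)
  note Ul = U_le[OF \<omega>]
  show "(\<lambda>n. V (?U n \<omega>) \<omega>) \<longlonglongrightarrow> left_lim V (U \<omega>) \<omega>"
  proof (cases "U \<omega> = 0")
    case True
    then show ?thesis by (simp add: left_lim_def)
  next
    case False
    then have pos: "0 < U \<omega>" using Ul by auto
    have lt: "?U n \<omega> < U \<omega>" for n using pos by auto
    have "(\<lambda>n. max 0 (U \<omega> - 1 / real (Suc n))) \<longlonglongrightarrow> max 0 (U \<omega> - 0)"
      using LIMSEQ_inverse_real_of_nat by (intro tendsto_intros) (simp add: inverse_eq_divide)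
    then have "filterlim (\<lambda>n. ?U n \<omega>) (at_left (U \<omega>)) sequentially"
      unfolding filterlim_at using lt pos Ul by (auto simp: less_imp_neq)
    moreover have "((\<lambda>t. V t \<omega>) \<longlongrightarrow> Lim (at_left (U \<omega>)) (\<lambda>t. V t \<omega>)) (at_left (U \<omega>))"
      using Ul pos q by (intro rcll_on_left_tendsto[OF rcll[OF \<omega>]]) auto
    ultimately show ?thesis
      using False by (simp add: left_lim_def) (rule filterlim_compose[rotated])
  qed
qed

section \<open>Sigma-algebras at fixed times and at stopping times\<close>

lemma subalgebra_F: "subalgebra M (F t)"
  using sets_F_subset by (simp add: subalgebra_def space_F)

lemma measurable_F_imp_M: "f \<in> borel_measurable (F t) \<Longrightarrow> f \<in> borel_measurable M"
  by (rule measurable_from_subalg[OF subalgebra_F])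

lemma sigma_finite_subalgebra:
  assumes "subalgebra M G" shows "sigma_finite_subalgebra M G"
proof -
  interpret finite_measure_subalgebra M G by standard (rule assms)
  show ?thesis by (rule sigma_finite_subalgebra_axioms)
qed

lemma measurable_stopping_min:
  assumes S: "stopping_time F S"
  shows "(\<lambda>\<omega>. min (S \<omega>) q) \<in> borel_measurable (F q)"
proof (rule borel_measurableI_le)
  fix a
  show "{\<omega> \<in> space (F q). min (S \<omega>) q \<le> a} \<in> sets (F q)"
  proof (cases "q \<le> a")
    case True
    then have "{\<omega> \<in> space (F q). min (S \<omega>) q \<le> a} = space (F q)" by auto
    then show ?thesis by (metis sets.top)
  next
    case False
    then have "{\<omega> \<in> space (F q). min (S \<omega>) q \<le> a} = {\<omega> \<in> space (F q). S \<omega> \<le> a}" by auto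
    then show ?thesis
      using stopping_time_le_const[OF S, of a q] False by (simp add: pred_def)
  qed
qed

text \<open>On \<open>S \<omega> \<le> t\<close> the value of \<open>Y\<close> at
  \<open>S \<omega>\<close> is its value at \<open>min (S \<omega>) t\<close>, so measurability at
  truncated times suffices. Since \<open>S\<close> is at most \<open>\<tau>\<close>, truncating at
  \<open>min t \<tau>\<close> has the same effect.\<close>

lemma measurable_pre_sigmaI:
  assumes S: "stopping_time F S" and S_le: "\<And>\<omega>. \<omega> \<in> space M \<Longrightarrow> 0 \<le> S \<omega> \<and> S \<omega> \<le> \<tau>"
    and Y: "\<And>q. 0 \<le> q \<Longrightarrow> q \<le> \<tau> \<Longrightarrow> (\<lambda>\<omega>. Y (min (S \<omega>) q) \<omega>) \<in> borel_measurable (F q)"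
  shows "(\<lambda>\<omega>. Y (S \<omega>) \<omega> :: real) \<in> borel_measurable (pre_sigma S)"
proof (intro borel_measurableI_le sets_pre_sigmaI[OF S])
  fix a t
  show "{\<omega> \<in> {\<omega> \<in> space (pre_sigma S). Y (S \<omega>) \<omega> \<le> a}. S \<omega> \<le> t} \<in> sets (F t)" (is "?A \<in> _")
  proof (cases "0 \<le> t \<and> 0 \<le> \<tau>")
    case True
    let ?q = "min t \<tau>"
    have "?A = {\<omega> \<in> space (F ?q). Y (min (S \<omega>) ?q) \<omega> \<le> a} \<inter> {\<omega> \<in> space (F t). S \<omega> \<le> t}"
      using S_le by (auto simp: space_F space_pre_sigma min_def)
    moreover have "{\<omega> \<in> space (F ?q). Y (min (S \<omega>) ?q) \<omega> \<le> a} \<in> sets (F ?q)"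
      using Y[of ?q] True by (intro borel_measurable_le) auto
    then have "{\<omega> \<in> space (F ?q). Y (min (S \<omega>) ?q) \<omega> \<le> a} \<in> sets (F t)"
      using sets_F_mono[of ?q t] by auto
    moreover have "{\<omega> \<in> space (F t). S \<omega> \<le> t} \<in> sets (F t)"
      using stopping_timeD[OF S, of t] by (simp add: pred_def)
    ultimately show ?thesis by auto
  next
    case False
    then have "?A = {}" using S_le by (force simp: space_pre_sigma)
    then show ?thesis by (metis sets.empty_sets)
  qed
qed

text \<open>As \<open>S\<close> is real-valued, a set is the countable union of its parts on
  \<open>S \<omega> \<le> n\<close>, each lying in \<open>F n\<close>.\<close>

lemma subalgebra_pre_sigma:
  assumes S: "stopping_time F S"
  shows "subalgebra M (pre_sigma S)"
proof -
  have "A \<in> sets M" if A: "A \<in> sets (pre_sigma S)" for A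
  proof -
    have "{\<omega>\<in>A. S \<omega> \<le> t} \<in> sets M" for t
      using sets_pre_sigmaD[OF S A, of t] sets_F_subset by auto
    then have "(\<Union>n::nat. {\<omega>\<in>A. S \<omega> \<le> real n}) \<in> sets M" by auto
    also have "(\<Union>n::nat. {\<omega>\<in>A. S \<omega> \<le> real n}) = A"
      using real_arch_simple by auto
    finally show ?thesis .
  qed
  then show ?thesis by (auto simp: subalgebra_def space_pre_sigma)
qed

lemma
  assumes S: "stopping_time F S" and S_le: "\<And>\<omega>. \<omega> \<in> space M \<Longrightarrow> 0 \<le> S \<omega> \<and> S \<omega> \<le> \<tau>"
  shows measurable_V_stopping_time: "(\<lambda>\<omega>. V (S \<omega>) \<omega>) \<in> borel_measurable (pre_sigma S)"
    and measurable_left_lim_stopping_time: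
      "(\<lambda>\<omega>. left_lim V (S \<omega>) \<omega>) \<in> borel_measurable (pre_sigma S)"
proof -
  have bounds: "0 \<le> min (S \<omega>) q \<and> min (S \<omega>) q \<le> q" if "0 \<le> q" "\<omega> \<in> space M" for q \<omega>
    using S_le[OF that(2)] that(1) by auto
  have "(\<lambda>\<omega>. V (min (S \<omega>) q) \<omega>) \<in> borel_measurable (F q)"
    "(\<lambda>\<omega>. left_lim V (min (S \<omega>) q) \<omega>) \<in> borel_measurable (F q)" if "0 \<le> q" "q \<le> \<tau>" for q
    using measurable_V_random_time[OF that measurable_stopping_min[OF S] bounds[OF that(1)]]
      measurable_left_lim_random_time[OF that measurable_stopping_min[OF S] bounds[OF that(1)]]
    by simp_all
  note meas = this
  show "(\<lambda>\<omega>. V (S \<omega>) \<omega>) \<in> borel_measurable (pre_sigma S)"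
    using meas(1) by (intro measurable_pre_sigmaI[OF S S_le, of "\<lambda>t \<omega>. V t \<omega>"]) simp_all
  show "(\<lambda>\<omega>. left_lim V (S \<omega>) \<omega>) \<in> borel_measurable (pre_sigma S)"
    using meas(2) by (intro measurable_pre_sigmaI[OF S S_le, of "\<lambda>t \<omega>. left_lim V t \<omega>"]) simp_all
qed

text \<open>Identifies the information at the zeroth exit time, which is constant, with
  \<open>F u\<close>.\<close>

lemma pre_sigma_const: "sets (pre_sigma (\<lambda>_. u)) = sets (F u)"
proof -
  have "A \<in> sets (pre_sigma (\<lambda>_. u)) \<longleftrightarrow> A \<in> sets (F u)" for A
    unfolding sets_pre_sigma[OF stopping_time_const]
  proof
    assume "A \<in> {A. \<forall>t. {\<omega> \<in> A. u \<le> t} \<in> sets (F t)}"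
    then have "{\<omega> \<in> A. u \<le> u} \<in> sets (F u)" by blast
    then show "A \<in> sets (F u)" by simp
  next
    assume "A \<in> sets (F u)"
    then have "{\<omega> \<in> A. u \<le> t} \<in> sets (F t)" for t
      using sets_F_mono[of u t] by (cases "u \<le> t") auto
    then show "A \<in> {A. \<forall>t. {\<omega> \<in> A. u \<le> t} \<in> sets (F t)}" by blast
  qed
  then show ?thesis by auto
qed

subsection \<open>Exit times from an interval\<close>

text \<open>Inserting \<open>v\<close> keeps the set nonempty and gives the value \<open>v\<close>
  when the level is never exceeded. The strict inequality makes exceedance an open condition, so
  that rational times detect it.\<close>

definition hit :: "real \<Rightarrow> ('a \<Rightarrow> real) \<Rightarrow> real \<Rightarrow> 'a \<Rightarrow> real"
  where "hit a S v \<omega> = Inf (insert v {x\<in>{S \<omega>..v}. a < \<bar>V x \<omega> - V (S \<omega>) \<omega>\<bar>})"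

context
  fixes a v :: real and S :: "'a \<Rightarrow> real"
  assumes v_le: "v \<le> \<tau>"
    and S_le: "\<And>\<omega>. \<omega> \<in> space M \<Longrightarrow> 0 \<le> S \<omega> \<and> S \<omega> \<le> v"
begin

lemma hit_bounds:
  assumes "\<omega> \<in> space M"
  shows "S \<omega> \<le> hit a S v \<omega>" "hit a S v \<omega> \<le> v"
  using S_le[OF assms] unfolding hit_def
  by (auto intro!: cInf_greatest cInf_lower bdd_belowI[of _ "S \<omega>"])

lemma hit_less_iff:
  assumes "\<omega> \<in> space M" "t \<le> v"
  shows "hit a S v \<omega> < t \<longleftrightarrow> (\<exists>x\<in>{S \<omega>..<t}. a < \<bar>V x \<omega> - V (S \<omega>) \<omega>\<bar>)"
proof -
  have "bdd_below (insert v {x\<in>{S \<omega>..v}. a < \<bar>V x \<omega> - V (S \<omega>) \<omega>\<bar>})"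
    using S_le[OF assms(1)] by (auto intro!: bdd_belowI[of _ "S \<omega>"])
  then show ?thesis
    unfolding hit_def using assms(2) by (subst cInf_less_iff) auto
qed

lemma before_hit:
  assumes "\<omega> \<in> space M" "S \<omega> \<le> x" "x < hit a S v \<omega>"
  shows "\<bar>V x \<omega> - V (S \<omega>) \<omega>\<bar> \<le> a"
proof -
  \<comment> \<open>Choosing \<open>t\<close> in \<open>hit_less_iff\<close> to be the hitting time
    itself rules out every earlier exceedance.\<close>
  have "\<not> hit a S v \<omega> < hit a S v \<omega>" by simp
  then show ?thesis
    using hit_less_iff[OF assms(1) hit_bounds(2)[OF assms(1)]] assms(2,3) by force
qed

text \<open>If the increment were below \<open>a\<close> at the hitting time, right continuity would
  keep it below \<open>a\<close> for a while longer, and the infimum would be larger. Equality with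
  \<open>a\<close> remains possible.\<close>

lemma at_hit:
  assumes "\<omega> \<in> space M" "hit a S v \<omega> < v"
  shows "a \<le> \<bar>V (hit a S v \<omega>) \<omega> - V (S \<omega>) \<omega>\<bar>"
proof (rule ccontr)
  let ?h = "hit a S v \<omega>"
  assume "\<not> ?thesis"
  then have less: "\<bar>V ?h \<omega> - V (S \<omega>) \<omega>\<bar> < a" by simp
  have "((\<lambda>s. \<bar>V s \<omega> - V (S \<omega>) \<omega>\<bar>) \<longlongrightarrow> \<bar>V ?h \<omega> - V (S \<omega>) \<omega>\<bar>) (at_right ?h)"
    using assms S_le hit_bounds[OF assms(1)] v_le
    by (intro tendsto_intros rcll_on_right_tendsto[OF rcll]) force+
  then have "\<forall>\<^sub>F s in at_right ?h. \<bar>V s \<omega> - V (S \<omega>) \<omega>\<bar> < a"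
    using less by (rule order_tendstoD)
  then obtain b where b: "b > ?h" "\<And>s. ?h < s \<Longrightarrow> s < b \<Longrightarrow> \<bar>V s \<omega> - V (S \<omega>) \<omega>\<bar> < a"
    unfolding eventually_at_right_field by blast
  have "?h < min b v" using b(1) assms(2) by simp
  then obtain x where x: "S \<omega> \<le> x" "x < min b v" "a < \<bar>V x \<omega> - V (S \<omega>) \<omega>\<bar>"
    using hit_less_iff[OF assms(1), of "min b v"] by auto
  then have "?h \<le> x" using before_hit[OF assms(1), of x] by force
  then show False
    using x(2,3) b(2)[of x] less by (cases "x = ?h") auto
qed

text \<open>The bound valid before the hitting time passes to the left limit. The strict inequality
  \<open>S \<omega> < hit a S v \<omega>\<close> ensures that a left neighbourhood of the hitting
  time lies after \<open>S \<omega>\<close>.\<close>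

lemma left_lim_at_hit:
  assumes \<omega>: "\<omega> \<in> space M" and less: "S \<omega> < hit a S v \<omega>"
  shows "\<bar>left_lim V (hit a S v \<omega>) \<omega> - V (S \<omega>) \<omega>\<bar> \<le> a"
proof -
  let ?h = "hit a S v \<omega>"
  have pos: "0 < ?h" using less S_le[OF \<omega>] by simp
  have "((\<lambda>s. V s \<omega>) \<longlongrightarrow> left_lim V ?h \<omega>) (at_left ?h)"
    using rcll_on_left_tendsto[OF rcll[OF \<omega>] pos] hit_bounds(2)[OF \<omega>] v_le pos
    by (simp add: left_lim_def)
  then have "((\<lambda>s. \<bar>V s \<omega> - V (S \<omega>) \<omega>\<bar>) \<longlongrightarrow> \<bar>left_lim V ?h \<omega> - V (S \<omega>) \<omega>\<bar>) (at_left ?h)"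
    by (intro tendsto_intros)
  moreover have "\<forall>\<^sub>F s in at_left ?h. \<bar>V s \<omega> - V (S \<omega>) \<omega>\<bar> \<le> a"
    unfolding eventually_at_left_field using before_hit[OF \<omega>] less
    by (intro exI[of _ "S \<omega>"]) auto
  ultimately show ?thesis
    by (rule tendsto_upperbound) simp
qed

text \<open>Right continuity of the paths turns \<open>hit < t\<close> into a countable union over rational times;
  right continuity of the filtration then passes from \<open>hit < t\<close> to \<open>hit \<le> t\<close>.\<close>

lemma stopping_time_hit:
  assumes S: "stopping_time F S"
  shows "stopping_time F (hit a S v)"
proof
  have less: "{\<omega> \<in> space M. hit a S v \<omega> < t} \<in> sets (F t)" if t: "0 \<le> t" "t \<le> v" for t
  proof -
    \<comment> \<open>On \<open>S \<omega> < q\<close> the truncation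
      \<open>min (S \<omega>) q\<close> changes nothing, but it makes the expression
      \<open>F q\<close>-measurable.\<close>
    let ?A = "\<lambda>q. {\<omega> \<in> space M. S \<omega> < q \<and> a < \<bar>V q \<omega> - V (min (S \<omega>) q) \<omega>\<bar>}"
    have "{\<omega> \<in> space M. hit a S v \<omega> < t} = (\<Union>q\<in>\<rat> \<inter> {0<..<t}. ?A q)"
    proof (intro set_eqI iffI)
      fix \<omega> assume "\<omega> \<in> {\<omega> \<in> space M. hit a S v \<omega> < t}"
      then have \<omega>: "\<omega> \<in> space M" and "hit a S v \<omega> < t" by auto
      then obtain x where x: "S \<omega> \<le> x" "x < t" "a < \<bar>V x \<omega> - V (S \<omega>) \<omega>\<bar>"
        using hit_less_iff[OF \<omega> t(2)] by auto
      obtain q where "q \<in> \<rat>" "x < q" "q < t" "a < \<bar>V q \<omega> - V (S \<omega>) \<omega>\<bar>"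
        using rcll_on_rational_witness[OF rcll[OF \<omega>] _ x(2) _ x(3)] S_le[OF \<omega>] x(1) t v_le
        by (smt (verit))
      then show "\<omega> \<in> (\<Union>q\<in>\<rat> \<inter> {0<..<t}. ?A q)"
        using \<omega> x(1) S_le[OF \<omega>] by (intro UN_I[of q]) auto
    next
      fix \<omega> assume "\<omega> \<in> (\<Union>q\<in>\<rat> \<inter> {0<..<t}. ?A q)"
      then obtain q where q: "q < t" "S \<omega> < q" "a < \<bar>V q \<omega> - V (S \<omega>) \<omega>\<bar>" and \<omega>: "\<omega> \<in> space M"
        by auto
      then show "\<omega> \<in> {\<omega> \<in> space M. hit a S v \<omega> < t}"
        using hit_less_iff[OF \<omega> t(2)] by auto
    qed
    moreover have "?A q \<in> sets (F t)" if q: "q \<in> \<rat> \<inter> {0<..<t}" for q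
    proof -
      have [measurable]: "V q \<in> borel_measurable (F q)"
        using q t v_le by (intro measurable_V) auto
      have [measurable]: "(\<lambda>\<omega>. V (min (S \<omega>) q) \<omega>) \<in> borel_measurable (F q)"
        using q t v_le S_le by (intro measurable_V_random_time measurable_stopping_min[OF S]) auto
      have [measurable]: "Measurable.pred (F q) (\<lambda>\<omega>. S \<omega> < q)"
        by (rule stopping_time_less_const[OF S])
      have "{\<omega> \<in> space (F q). S \<omega> < q \<and> a < \<bar>V q \<omega> - V (min (S \<omega>) q) \<omega>\<bar>} \<in> sets (F q)"
        by measurable
      then show ?thesis using sets_F_mono[of q t] q by (auto simp: space_F)
    qed
    ultimately show ?thesis
      using countable_rat by (auto intro!: sets.countable_UN'' intro: countable_subset)
  qed
  fix t
  have "{\<omega> \<in> space M. hit a S v \<omega> \<le> t} \<in> sets (F t)"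
  proof -
    consider "t < 0" | "v \<le> t" | "0 \<le> t" "t < v" by linarith
    then show ?thesis
    proof cases
      case 1
      then have "{\<omega> \<in> space M. hit a S v \<omega> \<le> t} = {}"
        using hit_bounds(1) S_le by force
      then show ?thesis by (metis sets.empty_sets)
    next
      case 2
      then have "{\<omega> \<in> space M. hit a S v \<omega> \<le> t} = space (F t)"
        using hit_bounds(2) by (force simp: space_F)
      then show ?thesis by (metis sets.top)
    next
      case 3
      have "{\<omega> \<in> space M. hit a S v \<omega> \<le> t} \<in> sets (F s)" if s: "t < s" for s
      proof -
        \<comment> \<open>Rationals below \<open>s\<close> keep the events in \<open>F s\<close>;
          rationals below \<open>v\<close> stay in the range covered by \<open>less\<close>.\<close>
        let ?Q = "\<rat> \<inter> {t<..<min s v}"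
        have "{\<omega> \<in> space M. hit a S v \<omega> \<le> t} = (\<Inter>q\<in>?Q. {\<omega> \<in> space M. hit a S v \<omega> < q})"
          (is "?L = ?R")
        proof
          show "?L \<subseteq> ?R" by auto
          \<comment> \<open>An index must exist for the intersection to be contained in
            \<open>space M\<close>.\<close>
          obtain q0 where q0: "q0 \<in> ?Q"
            using Rats_dense_in_real[of t "min s v"] s 3 by auto
          have "hit a S v \<omega> \<le> t" if "\<omega> \<in> ?R" for \<omega>
          proof (rule ccontr)
            assume "\<not> hit a S v \<omega> \<le> t"
            then obtain q where "q \<in> \<rat>" "t < q" "q < min (hit a S v \<omega>) (min s v)"
              using Rats_dense_in_real[of t "min (hit a S v \<omega>) (min s v)"] s 3 by auto
            then have "q \<in> ?Q" "q < hit a S v \<omega>" by auto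
            moreover have "hit a S v \<omega> < q" using that \<open>q \<in> ?Q\<close> by blast
            ultimately show False by simp
          qed
          then show "?R \<subseteq> ?L" using q0 by auto
        qed
        moreover have "{\<omega> \<in> space M. hit a S v \<omega> < q} \<in> sets (F s)" if "q \<in> ?Q" for q
          using less[of q] sets_F_mono[of q s] that 3 by auto
        moreover have "?Q \<noteq> {}"
          using Rats_dense_in_real[of t "min s v"] s 3 by auto
        ultimately show ?thesis
          using countable_rat
          by (auto intro!: sets.countable_INT' intro: countable_subset simp del: INT_simps)
      qed
      then show ?thesis using F_right_continuous[OF 3(1)] by auto
    qed
  qed
  then show "Measurable.pred (F t) (\<lambda>\<omega>. hit a S v \<omega> \<le> t)"
    by (simp add: pred_def space_F)
qed

end

subsection \<open>Tail of the maximal oscillation\<close>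

lemma bdd_above_osc:
  assumes "0 \<le> u" "v \<le> \<tau>" "\<omega> \<in> space M"
  shows "bdd_above ((\<lambda>t. \<bar>V t \<omega> - V u \<omega>\<bar>) ` {u..v})"
proof -
  obtain B where B: "\<And>t. t \<in> {0..\<tau>} \<Longrightarrow> \<bar>V t \<omega>\<bar> \<le> B"
    using rcll_on_bounded[OF rcll[OF assms(3)]] by blast
  have "\<bar>V t \<omega> - V u \<omega>\<bar> \<le> B + \<bar>V u \<omega>\<bar>" if "t \<in> {u..v}" for t
    using B[of t] that assms by auto
  then show ?thesis by (intro bdd_aboveI2[of _ _ "B + \<bar>V u \<omega>\<bar>"])
qed

definition max_osc :: "real \<Rightarrow> real \<Rightarrow> 'a \<Rightarrow> real"
  where "max_osc u v \<omega> = (SUP t\<in>{u..v}. \<bar>V t \<omega> - V u \<omega>\<bar>)"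

lemma max_osc_upper:
  assumes "0 \<le> u" "v \<le> \<tau>" "\<omega> \<in> space M" "t \<in> {u..v}"
  shows "\<bar>V t \<omega> - V u \<omega>\<bar> \<le> max_osc u v \<omega>"
  unfolding max_osc_def using assms by (intro cSUP_upper bdd_above_osc)

lemma max_osc_nonneg:
  assumes "0 \<le> u" "u \<le> v" "v \<le> \<tau>" "\<omega> \<in> space M"
  shows "0 \<le> max_osc u v \<omega>"
  using max_osc_upper[of u v \<omega> u] assms by simp

lemma max_osc_least:
  assumes "u \<le> v" "\<And>t. t \<in> {u..v} \<Longrightarrow> \<bar>V t \<omega> - V u \<omega>\<bar> \<le> c"
  shows "max_osc u v \<omega> \<le> c"
  unfolding max_osc_def using assms by (intro cSUP_least) auto

text \<open>An increment reaching past \<open>v\<close> splits at \<open>v\<close>, and its first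
  part is itself dominated by \<open>max_osc u v\<close>. This splits the exponential into factors
  when intervals are chained.\<close>

lemma max_osc_triangle:
  assumes "0 \<le> u" "u \<le> v" "v \<le> w" "w \<le> \<tau>" "\<omega> \<in> space M"
  shows "max_osc u w \<omega> \<le> max_osc u v \<omega> + max_osc v w \<omega>"
proof (rule max_osc_least)
  show "u \<le> w" using assms by simp
  fix t assume t: "t \<in> {u..w}"
  show "\<bar>V t \<omega> - V u \<omega>\<bar> \<le> max_osc u v \<omega> + max_osc v w \<omega>"
  proof (cases "t \<le> v")
    case True
    then show ?thesis
      using max_osc_upper[of u v \<omega> t] max_osc_nonneg[of v w \<omega>] assms t by simp
  next
    case False
    then show ?thesis
      using max_osc_upper[of v w \<omega> t] max_osc_upper[of u v \<omega> v] assms t by simp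
  qed
qed

lemma measurable_max_osc:
  assumes uv: "0 \<le> u" "u \<le> v" "v \<le> \<tau>"
  shows "max_osc u v \<in> borel_measurable (F v)"
proof (rule borel_measurableI_greater)
  fix y
  \<comment> \<open>The endpoint \<open>v\<close> is added because the interval contains no times to
    its right from which it could be approximated.\<close>
  let ?D = "insert v (\<rat> \<inter> {u..v})"
  have "{\<omega> \<in> space (F v). y < max_osc u v \<omega>}
    = (\<Union>q\<in>?D. {\<omega> \<in> space (F v). y < \<bar>V q \<omega> - V u \<omega>\<bar>})" (is "?L = ?R")
  proof (intro set_eqI iffI)
    fix \<omega> assume "\<omega> \<in> ?L"
    then have \<omega>: "\<omega> \<in> space M" and "y < max_osc u v \<omega>" by (auto simp: space_F)
    then obtain t where t: "t \<in> {u..v}" "y < \<bar>V t \<omega> - V u \<omega>\<bar>"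
      unfolding max_osc_def using less_cSUP_iff[OF _ bdd_above_osc[of u v \<omega>]] uv by auto
    have "\<exists>q\<in>?D. y < \<bar>V q \<omega> - V u \<omega>\<bar>"
    proof (cases "t = v")
      case False
      then obtain q where "q \<in> \<rat>" "t < q" "q < v" "y < \<bar>V q \<omega> - V u \<omega>\<bar>"
        using rcll_on_rational_witness[OF rcll[OF \<omega>] _ _ _ t(2), of v] t uv by auto
      then show ?thesis using t by (intro bexI[of _ q]) auto
    qed (use t in auto)
    then show "\<omega> \<in> ?R" using \<omega> by (auto simp: space_F)
  next
    fix \<omega> assume "\<omega> \<in> ?R"
    then have \<omega>: "\<omega> \<in> space M" and "\<exists>q\<in>?D. y < \<bar>V q \<omega> - V u \<omega>\<bar>"
      by (auto simp: space_F)
    then obtain q where "q \<in> ?D" "y < \<bar>V q \<omega> - V u \<omega>\<bar>"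
      by blast
    then show "\<omega> \<in> ?L"
      using max_osc_upper[OF uv(1,3) \<omega>, of q] uv \<omega> by (auto simp: space_F)
  qed
  moreover have "{\<omega> \<in> space (F v). y < \<bar>V q \<omega> - V u \<omega>\<bar>} \<in> sets (F v)" if "q \<in> ?D" for q
  proof -
    have [measurable]: "V q \<in> borel_measurable (F v)" "V u \<in> borel_measurable (F v)"
      using that uv by (auto intro!: measurable_V)
    show ?thesis by measurable
  qed
  ultimately show "{\<omega> \<in> space (F v). y < max_osc u v \<omega>} \<in> sets (F v)"
    using countable_rat by (auto intro!: sets.countable_UN'' intro: countable_subset)
qed

lemma measurable_max_osc_M:
  "0 \<le> u \<Longrightarrow> u \<le> v \<Longrightarrow> v \<le> \<tau> \<Longrightarrow> max_osc u v \<in> borel_measurable M"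
  by (rule measurable_F_imp_M[OF measurable_max_osc])

text \<open>Powers are monotone on nonnegative reals, and taking \<open>p\<close>-th roots gives the
  reverse bound. This links the supremum of powers in the theorem to \<open>max_osc\<close>.\<close>

lemma SUP_osc_power:
  assumes "0 \<le> u" "u \<le> v" "v \<le> \<tau>" "\<omega> \<in> space M" "1 \<le> p"
  shows "(SUP t\<in>{u..v}. \<bar>V t \<omega> - V u \<omega>\<bar> ^ p) = max_osc u v \<omega> ^ p"
proof (rule antisym)
  have le: "\<bar>V t \<omega> - V u \<omega>\<bar> ^ p \<le> max_osc u v \<omega> ^ p" if "t \<in> {u..v}" for t
    using max_osc_upper[OF assms(1,3,4) that] by (intro power_mono) auto
  then show "(SUP t\<in>{u..v}. \<bar>V t \<omega> - V u \<omega>\<bar> ^ p) \<le> max_osc u v \<omega> ^ p"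
    using assms by (intro cSUP_least) auto
  let ?s = "SUP t\<in>{u..v}. \<bar>V t \<omega> - V u \<omega>\<bar> ^ p"
  have up: "\<bar>V t \<omega> - V u \<omega>\<bar> ^ p \<le> ?s" if "t \<in> {u..v}" for t
    using that by (intro cSUP_upper bdd_aboveI2[OF le])
  have "0 \<le> ?s" using order_trans[OF _ up[of u]] assms by simp
  have "max_osc u v \<omega> \<le> root p ?s"
  proof (rule max_osc_least[OF assms(2)])
    fix t assume "t \<in> {u..v}"
    have "\<bar>V t \<omega> - V u \<omega>\<bar> = root p (\<bar>V t \<omega> - V u \<omega>\<bar> ^ p)"
      using assms(5) by (simp add: real_root_power_cancel)
    also have "\<dots> \<le> root p ?s"
      using up[OF \<open>t \<in> _\<close>] assms(5) by (intro real_root_le_mono) auto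
    finally show "\<bar>V t \<omega> - V u \<omega>\<bar> \<le> root p ?s" .
  qed
  then have "max_osc u v \<omega> ^ p \<le> root p ?s ^ p"
    using max_osc_nonneg[OF assms(1-4)] by (rule power_mono)
  also have "\<dots> = ?s" using assms(5) \<open>0 \<le> ?s\<close> by simp
  finally show "max_osc u v \<omega> ^ p \<le> ?s" .
qed

lemma
  assumes S: "stopping_time F S" and S_le: "\<And>\<omega>. \<omega> \<in> space M \<Longrightarrow> 0 \<le> S \<omega> \<and> S \<omega> \<le> \<tau>"
  shows measurable_V_stopping_time_M: "(\<lambda>\<omega>. V (S \<omega>) \<omega>) \<in> borel_measurable M"
    and measurable_left_lim_stopping_time_M: "(\<lambda>\<omega>. left_lim V (S \<omega>) \<omega>) \<in> borel_measurable M"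
  by (rule measurable_from_subalg[OF subalgebra_pre_sigma[OF S]],
      rule measurable_V_stopping_time[OF S S_le] measurable_left_lim_stopping_time[OF S S_le],
      assumption)+

section \<open>Geometric tail bound on one interval, for a positive real majorant of its
  modulus\<close>

context
  fixes u v \<rho> :: real
  assumes uv: "0 \<le> u" "u \<le> v" "v \<le> \<tau>"
    and \<rho>: "osc_modulus M F V u v \<le> ennreal \<rho>" "0 < \<rho>"
begin

lemma nn_cond_exp_osc_le:
  assumes ST: "stopping_time F S" "stopping_time F T"
    and le: "\<And>\<omega>. \<omega> \<in> space M \<Longrightarrow> u \<le> S \<omega> \<and> S \<omega> \<le> T \<omega> \<and> T \<omega> \<le> v"
  shows "AE \<omega> in M. nn_cond_exp M (pre_sigma S)
    (\<lambda>\<omega>. ennreal \<bar>V (T \<omega>) \<omega> - left_lim V (S \<omega>) \<omega>\<bar>) \<omega> \<le> ennreal \<rho>"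
proof -
  have "(S, T) \<in> stopping_pairs M F u v"
    using ST le by (auto simp: stopping_pairs_def)
  then have "mean_osc M F V S T \<le> osc_modulus M F V u v"
    unfolding osc_modulus_def by (intro SUP_upper2[where i = "(S, T)"]) auto
  then have "mean_osc M F V S T \<le> ennreal \<rho>"
    using \<rho> by simp
  then show ?thesis
    using esssup_AE[where M = M and f = "nn_cond_exp M (pre_sigma S)
      (\<lambda>\<omega>. ennreal \<bar>V (T \<omega>) \<omega> - left_lim V (S \<omega>) \<omega>\<bar>)"]
    by (auto simp: mean_osc_def elim!: eventually_mono)
qed

text \<open>With \<open>T = S\<close> the integrand is already measurable at \<open>S\<close>, so
  its conditional expectation is the jump itself.\<close>

lemma AE_jump_le:
  assumes S: "stopping_time F S" and le: "\<And>\<omega>. \<omega> \<in> space M \<Longrightarrow> u \<le> S \<omega> \<and> S \<omega> \<le> v"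
  shows "AE \<omega> in M. \<bar>V (S \<omega>) \<omega> - left_lim V (S \<omega>) \<omega>\<bar> \<le> \<rho>"
proof -
  have S_le: "0 \<le> S \<omega> \<and> S \<omega> \<le> \<tau>" if "\<omega> \<in> space M" for \<omega>
    using le[OF that] uv by auto
  interpret sigma_finite_subalgebra M "pre_sigma S"
    by (rule sigma_finite_subalgebra[OF subalgebra_pre_sigma[OF S]])
  note [measurable] = measurable_V_stopping_time[OF S S_le] measurable_left_lim_stopping_time[OF S S_le]
  have "AE \<omega> in M. ennreal \<bar>V (S \<omega>) \<omega> - left_lim V (S \<omega>) \<omega>\<bar> =
    nn_cond_exp M (pre_sigma S) (\<lambda>\<omega>. ennreal \<bar>V (S \<omega>) \<omega> - left_lim V (S \<omega>) \<omega>\<bar>) \<omega>"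
    by (rule nn_cond_exp_F_meas) measurable
  moreover have "AE \<omega> in M. nn_cond_exp M (pre_sigma S)
    (\<lambda>\<omega>. ennreal \<bar>V (S \<omega>) \<omega> - left_lim V (S \<omega>) \<omega>\<bar>) \<omega> \<le> ennreal \<rho>"
    using le by (intro nn_cond_exp_osc_le S) auto
  ultimately show ?thesis
  proof eventually_elim
    case (elim \<omega>)
    then have "ennreal \<bar>V (S \<omega>) \<omega> - left_lim V (S \<omega>) \<omega>\<bar> \<le> ennreal \<rho>" by (simp only:)
    then show ?case using \<rho> by simp
  qed
qed

text \<open>One \<open>\<rho>\<close> bounds the mean increment from the left limit at
  \<open>S\<close>, the other bounds the jump at \<open>S\<close>.\<close>

lemma set_nn_integral_increment_le:
  assumes ST: "stopping_time F S" "stopping_time F T"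
    and le: "\<And>\<omega>. \<omega> \<in> space M \<Longrightarrow> u \<le> S \<omega> \<and> S \<omega> \<le> T \<omega> \<and> T \<omega> \<le> v"
    and B: "B \<in> sets (pre_sigma S)"
  shows "(\<integral>\<^sup>+\<omega>\<in>B. ennreal \<bar>V (T \<omega>) \<omega> - V (S \<omega>) \<omega>\<bar> \<partial>M) \<le> ennreal (2 * \<rho>) * emeasure M B"
proof -
  have S_le: "0 \<le> S \<omega> \<and> S \<omega> \<le> \<tau>" and T_le: "0 \<le> T \<omega> \<and> T \<omega> \<le> \<tau>"
    and S_v: "u \<le> S \<omega> \<and> S \<omega> \<le> v" if "\<omega> \<in> space M" for \<omega>
    using le[OF that] uv by auto
  interpret sigma_finite_subalgebra M "pre_sigma S"
    by (rule sigma_finite_subalgebra[OF subalgebra_pre_sigma[OF ST(1)]])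
  have BM[measurable]: "B \<in> sets M" using B subalg by (auto simp: subalgebra_def)
  note [measurable] = B measurable_V_stopping_time_M[OF ST(1) S_le]
    measurable_V_stopping_time_M[OF ST(2) T_le] measurable_left_lim_stopping_time_M[OF ST(1) S_le]
  have jump: "AE \<omega> in M. \<bar>V (S \<omega>) \<omega> - left_lim V (S \<omega>) \<omega>\<bar> \<le> \<rho>"
    by (rule AE_jump_le[OF ST(1) S_v])
  have "(\<integral>\<^sup>+\<omega>\<in>B. ennreal \<bar>V (T \<omega>) \<omega> - V (S \<omega>) \<omega>\<bar> \<partial>M)
    \<le> (\<integral>\<^sup>+\<omega>. indicator B \<omega> * ennreal \<bar>V (T \<omega>) \<omega> - left_lim V (S \<omega>) \<omega>\<bar> +
         ennreal \<rho> * indicator B \<omega> \<partial>M)"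
  proof (rule nn_integral_mono_AE)
    show "AE \<omega> in M. ennreal \<bar>V (T \<omega>) \<omega> - V (S \<omega>) \<omega>\<bar> * indicator B \<omega>
      \<le> indicator B \<omega> * ennreal \<bar>V (T \<omega>) \<omega> - left_lim V (S \<omega>) \<omega>\<bar> + ennreal \<rho> * indicator B \<omega>"
      using jump
    proof eventually_elim
      case (elim \<omega>)
      then have "ennreal \<bar>V (T \<omega>) \<omega> - V (S \<omega>) \<omega>\<bar>
        \<le> ennreal (\<bar>V (T \<omega>) \<omega> - left_lim V (S \<omega>) \<omega>\<bar> + \<rho>)"
        by (intro ennreal_leI) auto
      then show ?case
        using \<rho> by (auto simp: indicator_def)
    qed
  qed
  also have "\<dots> = (\<integral>\<^sup>+\<omega>. indicator B \<omega> * ennreal \<bar>V (T \<omega>) \<omega> - left_lim V (S \<omega>) \<omega>\<bar> \<partial>M)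
      + ennreal \<rho> * emeasure M B"
    by (subst nn_integral_add) (auto simp: nn_integral_cmult)
  also have "\<dots> \<le> ennreal \<rho> * emeasure M B + ennreal \<rho> * emeasure M B"
  proof (rule add_right_mono)
    have "(\<integral>\<^sup>+\<omega>. indicator B \<omega> * ennreal \<bar>V (T \<omega>) \<omega> - left_lim V (S \<omega>) \<omega>\<bar> \<partial>M)
      \<le> ennreal \<rho> * (\<integral>\<^sup>+\<omega>. indicator B \<omega> \<partial>M)"
    proof (rule nn_integral_mult_le_of_nn_cond_exp_le)
      show "AE \<omega> in M. nn_cond_exp M (pre_sigma S)
        (\<lambda>\<omega>. ennreal \<bar>V (T \<omega>) \<omega> - left_lim V (S \<omega>) \<omega>\<bar>) \<omega> \<le> ennreal \<rho>"
        by (rule nn_cond_exp_osc_le[OF ST le])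
      show "indicator B \<in> borel_measurable (pre_sigma S)"
        using B by (rule borel_measurable_indicator)
    qed measurable
    then show "(\<integral>\<^sup>+\<omega>. indicator B \<omega> * ennreal \<bar>V (T \<omega>) \<omega> - left_lim V (S \<omega>) \<omega>\<bar> \<partial>M)
      \<le> ennreal \<rho> * emeasure M B" by simp
  qed
  also have "\<dots> = ennreal (2 * \<rho>) * emeasure M B"
  proof -
    have "ennreal (2 * \<rho>) = ennreal \<rho> + ennreal \<rho>"
      using \<rho> by (simp flip: ennreal_plus)
    then show ?thesis by (simp only: distrib_right)
  qed
  finally show ?thesis .
qed

text \<open>The level is twice the bound \<open>2 * \<rho>\<close> on mean increments, so that
  Markov's inequality yields the factor 1/2.\<close>

fun exit_time :: "nat \<Rightarrow> 'a \<Rightarrow> real" where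
  "exit_time 0 = (\<lambda>_. u)"
| "exit_time (Suc n) = hit (4 * \<rho>) (exit_time n) v"

lemma exit_time_bounds: "\<omega> \<in> space M \<Longrightarrow> u \<le> exit_time n \<omega> \<and> exit_time n \<omega> \<le> v"
proof (induction n arbitrary: \<omega>)
  case (Suc n)
  then have "0 \<le> exit_time n \<omega> \<and> exit_time n \<omega> \<le> v" if "\<omega> \<in> space M" for \<omega>
    using that uv by force
  then show ?case
    using hit_bounds[OF uv(3), of "exit_time n" \<omega> "4 * \<rho>"] Suc by force
qed (use uv in auto)

lemma exit_time_bounds0: "\<omega> \<in> space M \<Longrightarrow> 0 \<le> exit_time n \<omega> \<and> exit_time n \<omega> \<le> v"
  using exit_time_bounds[of \<omega> n] uv by auto

lemma exit_time_mono: "\<omega> \<in> space M \<Longrightarrow> exit_time n \<omega> \<le> exit_time (Suc n) \<omega>"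
  using hit_bounds(1)[OF uv(3) exit_time_bounds0] by simp

lemma stopping_time_exit_time: "stopping_time F (exit_time n)"
proof (induction n)
  case (Suc n)
  then show ?case
    using stopping_time_hit[OF uv(3) exit_time_bounds0] by simp
qed (simp add: stopping_time_const)

text \<open>Before an exit time the increment stays below \<open>4 * \<rho>\<close>, and the jump there is at most \<open>\<rho>\<close>.\<close>

lemma AE_increment_le_exit_time:
  "AE \<omega> in M. \<forall>n. \<forall>t\<in>{u..exit_time n \<omega>}. \<bar>V t \<omega> - V u \<omega>\<bar> \<le> 5 * \<rho> * real n"
proof -
  \<comment> \<open>Countably many exit times share a single null set outside of which all their
    jumps are bounded.\<close>
  have "AE \<omega> in M. \<forall>n. \<bar>V (exit_time n \<omega>) \<omega> - left_lim V (exit_time n \<omega>) \<omega>\<bar> \<le> \<rho>"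
    unfolding AE_all_countable
    using AE_jump_le[OF stopping_time_exit_time exit_time_bounds] by simp
  then show ?thesis
    using AE_space
  proof eventually_elim
    case (elim \<omega>)
    have "\<forall>t\<in>{u..exit_time n \<omega>}. \<bar>V t \<omega> - V u \<omega>\<bar> \<le> 5 * \<rho> * real n" for n
    proof (induction n)
      case (Suc n)
      let ?S = "exit_time n \<omega>" and ?T = "exit_time (Suc n) \<omega>"
      have IH: "\<bar>V t \<omega> - V u \<omega>\<bar> \<le> 5 * \<rho> * real n" if "u \<le> t" "t \<le> ?S" for t
        using Suc that by simp
      \<comment> \<open>Times after \<open>?S\<close> only: when \<open>?S = ?T\<close> the left
        limit at \<open>?T\<close> would refer to the path before \<open>?S\<close>.\<close>
      have "\<bar>V t \<omega> - V ?S \<omega>\<bar> \<le> 5 * \<rho>" if t: "?S < t" "t \<le> ?T" for t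
      proof (cases "t = ?T")
        case True
        have "\<bar>left_lim V ?T \<omega> - V ?S \<omega>\<bar> \<le> 4 * \<rho>"
          using left_lim_at_hit[where S = "exit_time n" and a = "4 * \<rho>", OF uv(3) exit_time_bounds0 elim(2)] t True by simp
        then show ?thesis unfolding True using elim(1)[rule_format, of "Suc n"] by linarith
      next
        case False
        then show ?thesis
          using before_hit[where S = "exit_time n" and a = "4 * \<rho>" and x = t, OF uv(3) exit_time_bounds0 elim(2)] t \<rho> by simp
      qed
      moreover have "\<bar>V ?S \<omega> - V u \<omega>\<bar> \<le> 5 * \<rho> * real n"
        using exit_time_bounds[OF elim(2), of n] by (intro IH) auto
      ultimately have step: "\<bar>V t \<omega> - V u \<omega>\<bar> \<le> 5 * \<rho> * real n + 5 * \<rho>" if "?S < t" "t \<le> ?T" for t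
        using that by fastforce
      have "\<bar>V t \<omega> - V u \<omega>\<bar> \<le> 5 * \<rho> * real n + 5 * \<rho>" if "u \<le> t" "t \<le> ?T" for t
      proof (cases "t \<le> ?S")
        case True
        then show ?thesis using IH[of t] that \<rho> by linarith
      next
        case False
        then show ?thesis using step[of t] that by linarith
      qed
      then have "\<bar>V t \<omega> - V u \<omega>\<bar> \<le> 5 * \<rho> * real (Suc n)" if "t \<in> {u..?T}" for t
        using that by (simp add: distrib_left add.commute del: exit_time.simps)
      then show ?case by blast
    qed simp
    then show ?case by blast
  qed
qed

text \<open>Defined by the size of the increment, the form Markov's inequality needs, rather than by
  stopping before \<open>v\<close>. The inequality is not strict, matching
  \<open>at_hit\<close>.\<close>

definition exits :: "nat \<Rightarrow> 'a set"
  where "exits k = {\<omega> \<in> space M. 4 * \<rho> \<le> \<bar>V (exit_time (Suc k) \<omega>) \<omega> - V (exit_time k \<omega>) \<omega>\<bar>}"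

text \<open>If exit \<open>k\<close> fails for some \<open>k < n\<close>, then by
  \<open>at_hit\<close> the exit time \<open>Suc k\<close> is \<open>v\<close>, and the bound up to
  that time covers all of \<open>{u..v}\<close>.\<close>

lemma AE_max_osc_imp_exits:
  "AE \<omega> in M. 5 * \<rho> * real n < max_osc u v \<omega> \<longrightarrow> (\<forall>k<n. \<omega> \<in> exits k)"
  using AE_increment_le_exit_time AE_space
proof eventually_elim
  case (elim \<omega>)
  have "max_osc u v \<omega> \<le> 5 * \<rho> * real n" if k: "k < n" "\<omega> \<notin> exits k" for k
  proof -
    have "exit_time (Suc k) \<omega> = v"
      using at_hit[where S = "exit_time k" and a = "4 * \<rho>", OF uv(3) exit_time_bounds0 elim(2)] k elim(2)
        exit_time_bounds[OF elim(2), of "Suc k"]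
      by (fastforce simp: exits_def)
    then have "max_osc u v \<omega> \<le> 5 * \<rho> * real (Suc k)"
      using elim(1)[rule_format, of _ "Suc k"] by (intro max_osc_least uv) simp
    also have "\<dots> \<le> 5 * \<rho> * real n"
      using k(1) \<rho> by (intro mult_left_mono) auto
    finally show ?thesis .
  qed
  then show ?case by (meson not_le)
qed

text \<open>Whether exit \<open>k\<close> occurs is known at exit time \<open>Suc k\<close>. The
  first \<open>n\<close> exits are thus past information at \<open>exit_time n\<close>, on which the
  next one can be conditioned.\<close>

lemma
  assumes B: "B \<in> sets (F u)"
  shows exits_pre_sigma: "B \<inter> (\<Inter>k<n. exits k) \<in> sets (pre_sigma (exit_time n))" (is ?thesis1)
    and prob_exits_le: "measure M (B \<inter> (\<Inter>k<n. exits k)) \<le> measure M B / 2 ^ n" (is ?thesis2)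
proof -
  define E where "E n = B \<inter> (\<Inter>k<n. exits k)" for n
  have E_Suc: "E (Suc n) = E n \<inter> exits n" for n
    by (auto simp: E_def lessThan_Suc)
  have st: "stopping_time F (exit_time n)" for n by (rule stopping_time_exit_time)
  have b: "\<omega> \<in> space M \<Longrightarrow> 0 \<le> exit_time n \<omega> \<and> exit_time n \<omega> \<le> \<tau>" for n \<omega>
    using exit_time_bounds0[of \<omega> n] uv by auto
  have mono: "sets (pre_sigma (exit_time n)) \<subseteq> sets (pre_sigma (exit_time (Suc n)))" for n
    by (rule mono_pre_sigma[OF st st exit_time_mono])
  have exits: "exits n \<in> sets (pre_sigma (exit_time (Suc n)))" for n
  proof -
    have "(\<lambda>\<omega>. V (exit_time n \<omega>) \<omega>) \<in> borel_measurable (pre_sigma (exit_time (Suc n)))"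
      by (rule borel_measurable_subalgebra[OF mono _ measurable_V_stopping_time[OF st b]])
         (auto simp: space_pre_sigma)
    note [measurable] = this measurable_V_stopping_time[OF st[of "Suc n"] b]
    have "{\<omega> \<in> space (pre_sigma (exit_time (Suc n))). 4 * \<rho> \<le>
        \<bar>V (exit_time (Suc n) \<omega>) \<omega> - V (exit_time n \<omega>) \<omega>\<bar>} \<in> sets (pre_sigma (exit_time (Suc n)))"
      by measurable
    then show ?thesis by (simp add: exits_def space_pre_sigma)
  qed
  have E: "E n \<in> sets (pre_sigma (exit_time n))" for n
  proof (induction n)
    case 0
    then show ?case using B by (simp add: E_def pre_sigma_const)
  next
    case (Suc n)
    then show ?case unfolding E_Suc using mono exits by blast
  qed
  have EM: "E n \<in> sets M" for n
    using E subalgebra_pre_sigma[OF st] by (auto simp: subalgebra_def)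
  have "measure M (E (Suc n)) \<le> measure M (E n) / 2" for n
  proof -
    \<comment> \<open>Markov's inequality on \<open>E n\<close>: the level \<open>4 * \<rho>\<close>
      against the mean bound \<open>2 * \<rho>\<close>.\<close>
    have "ennreal (4 * \<rho>) * emeasure M (E (Suc n)) = (\<integral>\<^sup>+\<omega>. ennreal (4 * \<rho>) * indicator (E (Suc n)) \<omega> \<partial>M)"
      using EM by (simp add: nn_integral_cmult)
    also have "\<dots> \<le> (\<integral>\<^sup>+\<omega>\<in>E n. ennreal \<bar>V (exit_time (Suc n) \<omega>) \<omega> - V (exit_time n \<omega>) \<omega>\<bar> \<partial>M)"
      by (intro nn_integral_mono) (auto simp: E_Suc exits_def indicator_def intro!: ennreal_leI)
    also have "\<dots> \<le> ennreal (2 * \<rho>) * emeasure M (E n)"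
      using exit_time_bounds exit_time_mono
      by (intro set_nn_integral_increment_le st E) blast
    finally have "4 * \<rho> * measure M (E (Suc n)) \<le> 2 * \<rho> * measure M (E n)"
      using \<rho> by (simp add: emeasure_eq_measure ennreal_mult[symmetric])
    then show ?thesis using \<rho> by simp
  qed
  then have "measure M (E n) \<le> measure M B / 2 ^ n" for n
  proof (induction n)
    case (Suc n)
    have "measure M (E (Suc n)) \<le> measure M (E n) / 2" by (rule Suc.prems)
    also have "\<dots> \<le> measure M B / 2 ^ n / 2" using Suc by simp
    finally show ?case by (simp add: field_simps)
  qed (simp add: E_def)
  then show ?thesis2 by (simp add: E_def)
  show ?thesis1 using E by (simp add: E_def)
qed

text \<open>Since \<open>B\<close> ranges over \<open>F u\<close>, this is the conditional tail
  bound given \<open>F u\<close> in integrated form.\<close>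

lemma prob_max_osc_le:
  assumes B: "B \<in> sets (F u)"
  shows "measure M {\<omega>\<in>B. 5 * \<rho> * real n < max_osc u v \<omega>} \<le> measure M B / 2 ^ n"
proof -
  have "measure M {\<omega>\<in>B. 5 * \<rho> * real n < max_osc u v \<omega>} \<le> measure M (B \<inter> (\<Inter>k<n. exits k))"
  proof (rule finite_measure_mono_AE)
    show "AE \<omega> in M. \<omega> \<in> {\<omega>\<in>B. 5 * \<rho> * real n < max_osc u v \<omega>} \<longrightarrow> \<omega> \<in> B \<inter> (\<Inter>k<n. exits k)"
      using AE_max_osc_imp_exits[of n] by eventually_elim auto
    show "B \<inter> (\<Inter>k<n. exits k) \<in> sets M"
      using exits_pre_sigma[OF B] subalgebra_pre_sigma[OF stopping_time_exit_time]
      by (auto simp: subalgebra_def)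
  qed
  then show ?thesis using prob_exits_le[OF B, of n] by simp
qed

end

end

subsection \<open>Moments and exponential moments\<close>

text \<open>The right side is the rising factorial \<open>(m + 1) * ... * (m + p)\<close>, each
  factor of which is at least \<open>m + 1\<close>.\<close>

lemma power_le_fact_times_binomial: "real (Suc m) ^ p \<le> fact p * real ((m + p) choose p)"
proof (induction p)
  case (Suc p)
  have "real (Suc m) ^ Suc p \<le> real (m + Suc p) * (fact p * real ((m + p) choose p))"
    unfolding power_Suc using Suc by (intro mult_mono) auto
  also have "\<dots> = fact p * real (Suc p * ((m + Suc p) choose Suc p))"
    by (subst binomial_absorption) (simp add: algebra_simps)
  also have "\<dots> = fact (Suc p) * real ((m + Suc p) choose Suc p)"
    by (simp add: algebra_simps)
  finally show ?case .
qed simp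

text \<open>These are partial sums of the negative binomial series at 1/2, whose value is
  \<open>2 ^ Suc q\<close>.\<close>

lemma sum_choose_div_power2_le: "(\<Sum>n<N. real ((q + n) choose q) / 2 ^ n) \<le> 2 ^ Suc q"
proof (induction q arbitrary: N)
  case 0
  have "(\<Sum>n<N. 1 / 2 ^ n) = 2 - 2 / (2 ^ N :: real)"
    by (induction N) simp_all
  then show ?case by simp
next
  case (Suc q)
  show ?case
  proof (induction N)
    case (Suc N)
    let ?s = "\<lambda>q n. real ((q + n) choose q) / 2 ^ n"
    \<comment> \<open>Pascal's rule expresses the sum by the one for \<open>q\<close> plus half of
      its own shorter version; the two induction hypotheses bound these by \<open>2 ^ Suc q\<close>
      each.\<close>
    have "?s (Suc q) (Suc n) = ?s q (Suc n) + ?s (Suc q) n / 2" for n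
      by (simp add: add_divide_distrib)
    then have "(\<Sum>n<Suc N. ?s (Suc q) n) = (\<Sum>n<Suc N. ?s q n) + (\<Sum>n<N. ?s (Suc q) n) / 2"
      by (simp add: sum.lessThan_Suc_shift sum.distrib sum_divide_distrib del: sum.lessThan_Suc)
    also have "\<dots> \<le> 2 ^ Suc q + 2 ^ Suc (Suc q) / 2"
      using \<open>\<And>N. (\<Sum>n<N. ?s q n) \<le> 2 ^ Suc q\<close>[of "Suc N"] Suc.IH
      by (intro add_mono divide_right_mono) auto
    finally show ?case by simp
  qed simp
qed

text \<open>Layers of height \<open>c\<close>: with \<open>c * m < x \<le> c * (m + 1)\<close>, the layers \<open>n \<le> m\<close> contribute
  \<open>c ^ p * fact p * ((m + p) choose p) \<ge> (c * (m + 1)) ^ p\<close>.\<close>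

lemma power_le_suminf_layers:
  fixes x c :: real
  assumes x: "0 \<le> x" and c: "0 < c" and p: "p = Suc q"
  shows "ennreal (x ^ p) \<le>
    (\<Sum>n. ennreal (c ^ p * fact p * real ((q + n) choose q)) * indicator {n. c * real n < x} n)"
proof (cases "x = 0")
  case False
  \<comment> \<open>The ceiling makes the layers open on the left, matching the strict inequality in
    the tail events.\<close>
  define m where "m = nat (\<lceil>x / c\<rceil> - 1)"
  have "0 < x / c" using False x c by simp
  then have m: "real m < x / c" "x / c \<le> real (Suc m)"
    unfolding m_def by linarith+
  have "x ^ p \<le> (c * real (Suc m)) ^ p"
    using x m(2) c by (intro power_mono) (auto simp: field_simps)
  also have "\<dots> \<le> c ^ p * (fact p * real ((m + p) choose p))"
    unfolding power_mult_distrib using c power_le_fact_times_binomial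
    by (intro mult_left_mono) (auto simp del: of_nat_Suc)
  \<comment> \<open>The hockey-stick identity distributes the binomial coefficient over the
    layers.\<close>
  also have "real ((m + p) choose p) = (\<Sum>n\<le>m. real ((q + n) choose q))"
    using choose_rising_sum(1)[of q m] p by (simp flip: of_nat_sum add: add.commute)
  finally have "ennreal (x ^ p) \<le> ennreal (\<Sum>n\<le>m. c ^ p * fact p * real ((q + n) choose q))"
    by (intro ennreal_leI) (simp add: sum_distrib_left mult.assoc)
  also have "\<dots> = (\<Sum>n\<le>m. ennreal (c ^ p * fact p * real ((q + n) choose q)))"
    using c by (intro sum_ennreal[symmetric]) auto
  also have "\<dots> = (\<Sum>n\<le>m. ennreal (c ^ p * fact p * real ((q + n) choose q)) * indicator {n. c * real n < x} n)"
  proof (rule sum.cong)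
    fix n assume "n \<in> {..m}"
    then have "real n < x / c" using m(1) by (intro le_less_trans[OF _ m(1)]) simp
    then have "c * real n < x" using c by (simp add: field_simps)
    then show "ennreal (c ^ p * fact p * real ((q + n) choose q)) =
      ennreal (c ^ p * fact p * real ((q + n) choose q)) * indicator {n. c * real n < x} n" by simp
  qed simp
  also have "\<dots> \<le> (\<Sum>n. ennreal (c ^ p * fact p * real ((q + n) choose q)) * indicator {n. c * real n < x} n)"
    by (intro sum_le_suminf summableI) auto
  finally show ?thesis .
qed (use p in auto)

section \<open>Conditional moments, exponential moments and the passage to short intervals\<close>

context rcll_process
begin

lemma sigma_finite_subalgebra_F: "sigma_finite_subalgebra M (F t)"
  by (rule sigma_finite_subalgebra[OF subalgebra_F])

lemma nn_cond_exp_F_leI: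
  assumes "f \<in> borel_measurable M" "C < \<infinity>"
    and "\<And>A. A \<in> sets (F t) \<Longrightarrow> (\<integral>\<^sup>+x\<in>A. f x \<partial>M) \<le> C * emeasure M A"
  shows "AE x in M. nn_cond_exp M (F t) f x \<le> C"
  using sigma_finite_subalgebra.nn_cond_exp_leI[OF sigma_finite_subalgebra_F assms(1,2) _ assms(3)]
    finite_measure_axioms by blast

context
  fixes u v \<rho> :: real
  assumes uv: "0 \<le> u" "u \<le> v" "v \<le> \<tau>"
    and \<rho>: "osc_modulus M F V u v \<le> ennreal \<rho>" "0 < \<rho>"
begin

text \<open>Layers of height \<open>5 * \<rho>\<close> are integrated with tail weights
  \<open>1 / 2 ^ n\<close>. The resulting series is at most \<open>2 ^ p\<close>, which turns
  \<open>5\<close> into \<open>10\<close>.\<close>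

lemma set_nn_integral_max_osc_power_le:
  assumes B: "B \<in> sets (F u)"
  shows "(\<integral>\<^sup>+\<omega>\<in>B. ennreal (max_osc u v \<omega> ^ p) \<partial>M) \<le> ennreal (fact p * (10 * \<rho>) ^ p) * emeasure M B"
\<comment> \<open>The layers need \<open>p = Suc q\<close>; the case \<open>p = 0\<close> is the
  constant term of the exponential series.\<close>
proof (cases p)
  case 0
  moreover have "B \<in> sets M" using B sets_F_subset by auto
  ultimately show ?thesis by simp
next
  case (Suc q)
  have BM[measurable]: "B \<in> sets M" using B sets_F_subset by auto
  have [measurable]: "max_osc u v \<in> borel_measurable M" by (rule measurable_max_osc_M[OF uv])
  let ?c = "\<lambda>n. (5 * \<rho>) ^ p * fact p * real ((q + n) choose q)"
  let ?A = "\<lambda>n::nat. {\<omega>\<in>B. 5 * \<rho> * real n < max_osc u v \<omega>}"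
  have A[measurable]: "?A n \<in> sets M" for n
  proof -
    have "?A n = B \<inter> {\<omega>\<in>space M. 5 * \<rho> * real n < max_osc u v \<omega>}"
      using sets.sets_into_space[OF \<open>B \<in> sets M\<close>] by auto
    then show ?thesis by simp
  qed
  have "(\<integral>\<^sup>+\<omega>\<in>B. ennreal (max_osc u v \<omega> ^ p) \<partial>M)
    \<le> (\<integral>\<^sup>+\<omega>. (\<Sum>n. ennreal (?c n) * indicator (?A n) \<omega>) \<partial>M)"
  proof (rule nn_integral_mono)
    fix \<omega> assume \<omega>: "\<omega> \<in> space M"
    show "ennreal (max_osc u v \<omega> ^ p) * indicator B \<omega> \<le> (\<Sum>n. ennreal (?c n) * indicator (?A n) \<omega>)"
    proof (cases "\<omega> \<in> B")
      case True
      then have "indicator (?A n) \<omega> = (indicator {n. 5 * \<rho> * real n < max_osc u v \<omega>} n :: ennreal)" for n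
        by (simp add: indicator_def)
      then show ?thesis
        using power_le_suminf_layers[OF max_osc_nonneg[OF uv \<omega>] _ Suc, of "5 * \<rho>"] \<rho> True by simp
    qed simp
  qed
  also have "\<dots> = (\<Sum>n. ennreal (?c n) * emeasure M (?A n))"
    by (subst nn_integral_suminf) (auto simp: nn_integral_cmult_indicator)
  also have "\<dots> \<le> ennreal (fact p * (10 * \<rho>) ^ p * measure M B)"
  proof (intro suminf_le_const summableI)
    fix N
    have "(\<Sum>n<N. ennreal (?c n) * emeasure M (?A n)) = ennreal (\<Sum>n<N. ?c n * measure M (?A n))"
      using \<rho> by (subst sum_ennreal[symmetric]) (auto simp: emeasure_eq_measure ennreal_mult)
    also have "\<dots> \<le> ennreal (\<Sum>n<N. ?c n * (measure M B / 2 ^ n))"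
      using \<rho> prob_max_osc_le[OF uv \<rho> B]
      by (intro ennreal_leI sum_mono mult_left_mono) auto
    also have "(\<Sum>n<N. ?c n * (measure M B / 2 ^ n))
      = (5 * \<rho>) ^ p * fact p * measure M B * (\<Sum>n<N. real ((q + n) choose q) / 2 ^ n)"
      by (simp add: sum_distrib_left algebra_simps)
    also have "ennreal \<dots> \<le> ennreal ((5 * \<rho>) ^ p * fact p * measure M B * 2 ^ Suc q)"
      using \<rho> sum_choose_div_power2_le[of q N] by (intro ennreal_leI mult_left_mono) auto
    also have "(5 * \<rho>) ^ p * fact p * measure M B * 2 ^ Suc q = fact p * (10 * \<rho>) ^ p * measure M B"
    proof -
      have "10 * \<rho> = 5 * \<rho> * 2" by simp
      then have *: "(10 * \<rho>) ^ p = (5 * \<rho>) ^ p * 2 ^ p"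
        by (simp only: power_mult_distrib[of "5 * \<rho>" 2])
      show ?thesis unfolding * Suc[symmetric] by (simp only: mult_ac)
    qed
    finally show "(\<Sum>n<N. ennreal (?c n) * emeasure M (?A n)) \<le> ennreal (fact p * (10 * \<rho>) ^ p * measure M B)" .
  qed
  finally show ?thesis
    using \<rho> by (simp add: emeasure_eq_measure ennreal_mult)
qed

text \<open>In the exponential series the factorials cancel against those of the moment bounds,
  leaving a geometric series of ratio \<open>l * (10 * \<rho>)\<close>.\<close>

lemma set_nn_integral_exp_max_osc_le:
  assumes B: "B \<in> sets (F u)" and l: "0 \<le> l" "l * (10 * \<rho>) < 1"
  shows "(\<integral>\<^sup>+\<omega>\<in>B. ennreal (exp (l * max_osc u v \<omega>)) \<partial>M)
    \<le> ennreal (1 / (1 - l * (10 * \<rho>))) * emeasure M B"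
proof -
  have [measurable]: "B \<in> sets M" using B sets_F_subset by auto
  have [measurable]: "max_osc u v \<in> borel_measurable M" by (rule measurable_max_osc_M[OF uv])
  have "(\<integral>\<^sup>+\<omega>\<in>B. ennreal (exp (l * max_osc u v \<omega>)) \<partial>M)
    = (\<integral>\<^sup>+\<omega>. (\<Sum>p. ennreal (l ^ p / fact p) * (ennreal (max_osc u v \<omega> ^ p) * indicator B \<omega>)) \<partial>M)"
  proof (rule nn_integral_cong)
    fix \<omega> assume \<omega>: "\<omega> \<in> space M"
    have "(\<lambda>p. l ^ p / fact p * max_osc u v \<omega> ^ p) sums exp (l * max_osc u v \<omega>)"
      using exp_converges[of "l * max_osc u v \<omega>"]
      by (simp add: field_simps)
    then have *: "(\<Sum>p. ennreal (l ^ p / fact p * max_osc u v \<omega> ^ p)) = ennreal (exp (l * max_osc u v \<omega>))"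
      using l max_osc_nonneg[OF uv \<omega>] by (intro suminf_ennreal_eq) auto
    have "ennreal (l ^ p / fact p * max_osc u v \<omega> ^ p) =
        ennreal (l ^ p / fact p) * ennreal (max_osc u v \<omega> ^ p)" for p
      using l max_osc_nonneg[OF uv \<omega>] by (intro ennreal_mult) auto
    from *[unfolded this] show "ennreal (exp (l * max_osc u v \<omega>)) * indicator B \<omega> =
      (\<Sum>p. ennreal (l ^ p / fact p) * (ennreal (max_osc u v \<omega> ^ p) * indicator B \<omega>))"
      by (cases "\<omega> \<in> B") simp_all
  qed
  also have "\<dots> = (\<Sum>p. ennreal (l ^ p / fact p) * (\<integral>\<^sup>+\<omega>\<in>B. ennreal (max_osc u v \<omega> ^ p) \<partial>M))"
    by (subst nn_integral_suminf) (auto simp: nn_integral_cmult)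
  also have "\<dots> \<le> (\<Sum>p. ennreal ((l * (10 * \<rho>)) ^ p) * emeasure M B)"
  proof (intro suminf_le summableI)
    fix p
    have "ennreal (l ^ p / fact p) * (\<integral>\<^sup>+\<omega>\<in>B. ennreal (max_osc u v \<omega> ^ p) \<partial>M)
      \<le> ennreal (l ^ p / fact p) * (ennreal (fact p * (10 * \<rho>) ^ p) * emeasure M B)"
      by (intro mult_left_mono set_nn_integral_max_osc_power_le B) auto
    also have "\<dots> = ennreal (l ^ p / fact p * (fact p * (10 * \<rho>) ^ p)) * emeasure M B"
      using l \<rho> by (subst ennreal_mult) (auto simp: mult.assoc)
    also have "l ^ p / fact p * (fact p * (10 * \<rho>) ^ p) = (l * (10 * \<rho>)) ^ p"
      by (simp add: power_mult_distrib)
    finally show "ennreal (l ^ p / fact p) * (\<integral>\<^sup>+\<omega>\<in>B. ennreal (max_osc u v \<omega> ^ p) \<partial>M)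
      \<le> ennreal ((l * (10 * \<rho>)) ^ p) * emeasure M B" .
  qed
  also have "\<dots> = ennreal (1 / (1 - l * (10 * \<rho>))) * emeasure M B"
  proof -
    have "(\<Sum>p. ennreal ((l * (10 * \<rho>)) ^ p)) = ennreal (1 / (1 - l * (10 * \<rho>)))"
      using l \<rho> by (intro suminf_ennreal_eq geometric_sums) auto
    then show ?thesis by simp
  qed
  finally show ?thesis .
qed

end

text \<open>Induction on the number of steps of length \<open>h\<close> that reach
  \<open>\<tau>\<close>: conditioning at the end of the first step bounds the remaining factor, and
  each step costs the same constant.\<close>

lemma nn_cond_exp_exp_max_osc_le:
  assumes r: "0 \<le> r" "r \<le> \<tau>" and h: "0 < h" and \<rho>: "0 < \<rho>" and l: "0 \<le> l" "l * (10 * \<rho>) < 1"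
    and osc: "\<And>u v. r \<le> u \<Longrightarrow> u \<le> v \<Longrightarrow> v \<le> \<tau> \<Longrightarrow> v - u \<le> h \<Longrightarrow> osc_modulus M F V u v \<le> ennreal \<rho>"
    and u: "r \<le> u" "u \<le> \<tau>" "\<tau> - u \<le> real k * h"
  shows "AE \<omega> in M. nn_cond_exp M (F u) (\<lambda>\<omega>. ennreal (exp (l * max_osc u \<tau> \<omega>))) \<omega>
    \<le> ennreal ((1 / (1 - l * (10 * \<rho>))) ^ Suc k)"
  using u
proof (induction k arbitrary: u)
  \<comment> \<open>Here \<open>u = \<tau>\<close>, and the degenerate interval is charged one
    constant as well, hence the exponent \<open>Suc k\<close>.\<close>
  case 0
  note [measurable] = measurable_max_osc_M[OF order_trans[OF r(1) 0(1)] 0(2) order_refl]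
  show ?case
  proof (rule nn_cond_exp_F_leI)
    fix A assume "A \<in> sets (F u)"
    then show "(\<integral>\<^sup>+\<omega>\<in>A. ennreal (exp (l * max_osc u \<tau> \<omega>)) \<partial>M)
      \<le> ennreal ((1 / (1 - l * (10 * \<rho>))) ^ Suc 0) * emeasure M A"
      using set_nn_integral_exp_max_osc_le[OF _ 0(2) order_refl osc \<rho>] 0 r h l by simp
  qed simp_all
next
  case (Suc k)
  let ?C = "1 / (1 - l * (10 * \<rho>))"
  define v where "v = min \<tau> (u + h)"
  have v: "0 \<le> u" "u \<le> v" "v \<le> \<tau>" "r \<le> v" "v - u \<le> h" and vk: "\<tau> - v \<le> real k * h"
    using Suc.prems h r by (auto simp: v_def min_def algebra_simps)
  have C: "0 \<le> ?C" using l by simp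
  have uv[measurable]: "max_osc u v \<in> borel_measurable (F v)"
    by (rule measurable_max_osc) (use v in auto)
  have [measurable]: "max_osc u \<tau> \<in> borel_measurable M" "max_osc v \<tau> \<in> borel_measurable M"
    "max_osc u v \<in> borel_measurable M"
    using v by (auto intro!: measurable_max_osc_M)
  show ?case
  proof (rule nn_cond_exp_F_leI)
    fix A assume A: "A \<in> sets (F u)"
    then have Av[measurable]: "A \<in> sets (F v)" using sets_F_mono[OF v(2)] by auto
    have [measurable]: "A \<in> sets M" using A sets_F_subset by auto
    \<comment> \<open>This weight depends only on the past of \<open>v\<close>, so the conditional
      bound of the induction hypothesis applies to the other factor.\<close>
    let ?g = "\<lambda>\<omega>. ennreal (exp (l * max_osc u v \<omega>)) * indicator A \<omega>"
    have "(\<integral>\<^sup>+\<omega>\<in>A. ennreal (exp (l * max_osc u \<tau> \<omega>)) \<partial>M)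
      \<le> (\<integral>\<^sup>+\<omega>. ?g \<omega> * ennreal (exp (l * max_osc v \<tau> \<omega>)) \<partial>M)"
    proof (rule nn_integral_mono)
      fix \<omega> assume \<omega>: "\<omega> \<in> space M"
      have "l * max_osc u \<tau> \<omega> \<le> l * max_osc u v \<omega> + l * max_osc v \<tau> \<omega>"
        using mult_left_mono[OF max_osc_triangle[OF v(1-3) order_refl \<omega>] l(1)]
        by (simp add: distrib_left)
      then have "exp (l * max_osc u \<tau> \<omega>) \<le> exp (l * max_osc u v \<omega>) * exp (l * max_osc v \<tau> \<omega>)"
        by (simp flip: exp_add)
      then show "ennreal (exp (l * max_osc u \<tau> \<omega>)) * indicator A \<omega>
        \<le> ?g \<omega> * ennreal (exp (l * max_osc v \<tau> \<omega>))"
        by (auto simp: indicator_def ennreal_mult[symmetric] intro: ennreal_leI)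
    qed
    also have "\<dots> \<le> ennreal (?C ^ Suc k) * (\<integral>\<^sup>+\<omega>. ?g \<omega> \<partial>M)"
    proof (rule sigma_finite_subalgebra.nn_integral_mult_le_of_nn_cond_exp_le
        [OF sigma_finite_subalgebra_F[of v]])
      show "AE \<omega> in M. nn_cond_exp M (F v) (\<lambda>\<omega>. ennreal (exp (l * max_osc v \<tau> \<omega>))) \<omega>
        \<le> ennreal (?C ^ Suc k)"
        by (rule Suc.IH) (use v vk in auto)
    qed measurable
    also have "\<dots> \<le> ennreal (?C ^ Suc k) * (ennreal ?C * emeasure M A)"
      using set_nn_integral_exp_max_osc_le[OF v(1-3) osc \<rho> A l] v Suc.prems
      by (intro mult_left_mono) auto
    also have "\<dots> = ennreal (?C ^ Suc (Suc k)) * emeasure M A"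
    proof -
      have "ennreal (?C ^ Suc (Suc k)) = ennreal (?C ^ Suc k) * ennreal ?C"
        by (subst power_Suc2, rule ennreal_mult) (intro zero_le_power C)+
      then show ?thesis by (simp only: mult.assoc)
    qed
    finally show "(\<integral>\<^sup>+\<omega>\<in>A. ennreal (exp (l * max_osc u \<tau> \<omega>)) \<partial>M)
      \<le> ennreal (?C ^ Suc (Suc k)) * emeasure M A" .
  qed simp_all
qed

text \<open>The inner supremum is monotone in \<open>h\<close>, so the limit at \<open>0\<close>
  exists and equals the infimum over \<open>h > 0\<close>; some \<open>h\<close> then gets below
  \<open>c\<close>.\<close>

lemma osc_kappa_less_imp:
  assumes "osc_kappa M F V s t < c"
  obtains h where "0 < h"
    "\<And>u v. s \<le> u \<Longrightarrow> u \<le> v \<Longrightarrow> v \<le> t \<Longrightarrow> v - u \<le> h \<Longrightarrow> osc_modulus M F V u v \<le> c"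
proof -
  define g where "g h = (SUP (u, v)\<in>{(u, v). s \<le> u \<and> u \<le> v \<and> v \<le> t \<and> v - u \<le> h}. osc_modulus M F V u v)"
    for h
  have mono: "g h \<le> g h'" if "h \<le> h'" for h h'
    unfolding g_def using that by (intro SUP_subset_mono) auto
  have "(g \<longlongrightarrow> (INF h\<in>{0<..}. g h)) (at_right 0)"
  proof (rule order_tendstoI)
    fix a assume "a < (INF h\<in>{0<..}. g h)"
    then have "a < g h" if "0 < h" for h
      using that by (auto intro: less_le_trans INF_lower)
    then show "\<forall>\<^sub>F h in at_right 0. a < g h"
      by (auto simp: eventually_at_right_field intro: exI[of _ 1])
  next
    fix a assume "(INF h\<in>{0<..}. g h) < a"
    then obtain h where "0 < h" "g h < a" by (auto simp: INF_less_iff)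
    then show "\<forall>\<^sub>F h in at_right 0. g h < a"
      using mono by (auto simp: eventually_at_right_field intro!: exI[of _ h] intro: le_less_trans less_imp_le)
  qed
  then have "osc_kappa M F V s t = (INF h\<in>{0<..}. g h)"
    unfolding osc_kappa_def g_def[symmetric] by (intro tendsto_Lim) simp_all
  then obtain h where h: "0 < h" "g h < c"
    using assms by (auto simp: INF_less_iff)
  have "osc_modulus M F V u v \<le> c" if "s \<le> u" "u \<le> v" "v \<le> t" "v - u \<le> h" for u v
  proof -
    have "osc_modulus M F V u v \<le> g h"
      unfolding g_def using that by (intro SUP_upper2[where i = "(u, v)"]) auto
    then show ?thesis using h(2) by simp
  qed
  then show ?thesis using that h(1) by blast
qed

end

text \<open>Taking reciprocals reverses the inequality. For \<open>k = 0\<close> the inverse is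
  infinite and the conclusion only needs \<open>l > 0\<close>; for infinite \<open>k\<close> the
  inverse is \<open>0\<close>, contradicting \<open>l > 0\<close>.\<close>

lemma less_inverse_ennreal_imp:
  assumes l: "0 < l" "ereal l < enn2ereal (inverse (11 * k))"
  shows "k < ennreal (1 / (11 * l))"
proof -
  have "enn2ereal (ennreal l) < enn2ereal (inverse (11 * k))"
    using l by simp
  then have less: "ennreal l < inverse (11 * k)"
    by (simp add: less_ennreal.rep_eq)
  show ?thesis
  proof (cases k rule: ennreal_cases)
    case (real x)
    show ?thesis
    proof (cases "x = 0")
      case False
      then have "0 < 11 * x" using real by simp
      moreover have "11 * k = ennreal (11 * x)" using real by (simp add: ennreal_mult)
      ultimately have "inverse (11 * k) = ennreal (1 / (11 * x))"
        by (simp only: inverse_ennreal inverse_eq_divide)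
      then have "l < 1 / (11 * x)" using less l by (simp add: ennreal_less_iff)
      then have "x < 1 / (11 * l)" using l real False by (simp add: field_simps)
      then show ?thesis using real by (simp add: ennreal_less_iff)
    qed (use real l in \<open>simp add: ennreal_less_iff\<close>)
  next
    case top
    then show ?thesis using less by (simp add: ennreal_mult_top)
  qed
qed

theorem theorem2p3:
  fixes M :: "'a measure" and F :: "real \<Rightarrow> 'a measure"
    and V :: "real \<Rightarrow> 'a \<Rightarrow> real" and \<tau> r :: real
  assumes "usual_filtered_prob_space M F"
    and "0 < \<tau>"
    and "bmo_process M F \<tau> V"
    and "r \<in> {0..\<tau>}"
  shows "(\<forall>p::nat. 1 \<le> p \<longrightarrow>
            esssup M (nn_cond_exp M (F r) (\<lambda>\<omega>. ennreal (SUP t\<in>{r..\<tau>}. \<bar>V t \<omega> - V r \<omega>\<bar> ^ p)))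
              \<le> of_nat (fact p) * (11 * osc_modulus M F V r \<tau>) ^ p)
       \<and> (\<forall>l::real. ereal l < enn2ereal (inverse (11 * osc_kappa M F V r \<tau>)) \<longrightarrow>
            (AE \<omega> in M. nn_cond_exp M (F r)
               (\<lambda>\<omega>. ennreal (exp (l * (SUP t\<in>{r..\<tau>}. \<bar>V t \<omega> - V r \<omega>\<bar>)))) \<omega> < \<infinity>))"
proof -
  interpret usual_filtered_prob_space M F by (rule assms(1))
  interpret rcll_process M F V \<tau>
    using assms(3) by unfold_locales (auto simp: bmo_process_def)
  have r: "0 \<le> r" "r \<le> \<tau>" using assms(4) by auto
  note [measurable] = measurable_max_osc_M[OF r order_refl]
  have "osc_modulus M F V r \<tau> \<le> bmo_seminorm M F \<tau> V"
    unfolding osc_modulus_def bmo_seminorm_def using r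
    by (intro SUP_subset_mono) (force simp: stopping_pairs_def)+
  then have "osc_modulus M F V r \<tau> < \<infinity>"
    using assms(3) by (auto simp: bmo_process_def)
  then obtain R where R: "osc_modulus M F V r \<tau> = ennreal R" "0 \<le> R"
    by (cases "osc_modulus M F V r \<tau>" rule: ennreal_cases) auto
  have "esssup M (nn_cond_exp M (F r) (\<lambda>\<omega>. ennreal (SUP t\<in>{r..\<tau>}. \<bar>V t \<omega> - V r \<omega>\<bar> ^ p)))
    \<le> of_nat (fact p) * (11 * osc_modulus M F V r \<tau>) ^ p" (is "?e \<le> _") if p: "1 \<le> p" for p
  proof -
    let ?f = "\<lambda>\<omega>. ennreal (SUP t\<in>{r..\<tau>}. \<bar>V t \<omega> - V r \<omega>\<bar> ^ p)"
    have f: "?f \<omega> = ennreal (max_osc r \<tau> \<omega> ^ p)" if "\<omega> \<in> space M" for \<omega>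
      using SUP_osc_power[OF r order_refl that p] by simp
    have meas: "?f \<in> borel_measurable M"
      using f by (subst measurable_cong) auto
    \<comment> \<open>Since \<open>R\<close> may be \<open>0\<close> while exit levels must be
      positive, the bound is first proved for every positive \<open>\<rho> \<ge> R\<close>; then
      \<open>\<rho>\<close> tends to \<open>R\<close> along \<open>R + 1 / (n + 1)\<close>.\<close>
    have le: "?e \<le> ennreal (fact p * (10 * \<rho>) ^ p)" if \<rho>: "R \<le> \<rho>" "0 < \<rho>" for \<rho>
    proof (intro esssup_I borel_measurable_nn_cond_exp2 nn_cond_exp_F_leI meas)
      fix A assume A: "A \<in> sets (F r)"
      have "(\<integral>\<^sup>+\<omega>\<in>A. ?f \<omega> \<partial>M) = (\<integral>\<^sup>+\<omega>\<in>A. ennreal (max_osc r \<tau> \<omega> ^ p) \<partial>M)"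
        using f by (intro nn_integral_cong) simp
      also have "\<dots> \<le> ennreal (fact p * (10 * \<rho>) ^ p) * emeasure M A"
        using set_nn_integral_max_osc_power_le[OF r order_refl _ \<rho>(2) A] R \<rho> by (simp add: ennreal_leI)
      finally show "(\<integral>\<^sup>+\<omega>\<in>A. ?f \<omega> \<partial>M) \<le> ennreal (fact p * (10 * \<rho>) ^ p) * emeasure M A" .
    qed simp
    have "(\<lambda>n. R + inverse (real (Suc n))) \<longlonglongrightarrow> R + 0"
      by (intro tendsto_intros LIMSEQ_inverse_real_of_nat)
    then have "(\<lambda>n. ennreal (fact p * (10 * (R + inverse (real (Suc n)))) ^ p))
        \<longlonglongrightarrow> ennreal (fact p * (10 * R) ^ p)"
      by (intro tendsto_intros tendsto_ennrealI) simp
    moreover have "?e \<le> ennreal (fact p * (10 * (R + inverse (real (Suc n)))) ^ p)" for n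
      using R by (intro le add_nonneg_pos) auto
    ultimately have "?e \<le> ennreal (fact p * (10 * R) ^ p)"
      using LIMSEQ_le_const by blast
    also have "\<dots> \<le> ennreal (fact p * (11 * R) ^ p)"
      using R by (intro ennreal_leI mult_left_mono power_mono) auto
    also have "\<dots> = of_nat (fact p) * (11 * osc_modulus M F V r \<tau>) ^ p"
      using R ennreal_of_nat_eq_real_of_nat[of "fact p"]
      by (simp add: ennreal_mult ennreal_power[symmetric])
    finally show ?thesis .
  qed
  moreover have "AE \<omega> in M. nn_cond_exp M (F r)
      (\<lambda>\<omega>. ennreal (exp (l * (SUP t\<in>{r..\<tau>}. \<bar>V t \<omega> - V r \<omega>\<bar>)))) \<omega> < \<infinity>"
    if l: "ereal l < enn2ereal (inverse (11 * osc_kappa M F V r \<tau>))" for l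
    unfolding max_osc_def[symmetric]
  proof (cases "0 < l")
    case True
    \<comment> \<open>With this choice \<open>l * (10 * ?\<rho>) = 10 / 11 < 1\<close>: the gap
      between \<open>10\<close> and \<open>11\<close> makes the geometric series converge.\<close>
    let ?\<rho> = "1 / (11 * l)"
    obtain h where h: "0 < h" "\<And>u v. r \<le> u \<Longrightarrow> u \<le> v \<Longrightarrow> v \<le> \<tau> \<Longrightarrow> v - u \<le> h \<Longrightarrow>
        osc_modulus M F V u v \<le> ennreal ?\<rho>"
      using osc_kappa_less_imp[OF less_inverse_ennreal_imp[OF True l]] by blast
    obtain k :: nat where "(\<tau> - r) / h \<le> real k" using real_arch_simple by blast
    then have "\<tau> - r \<le> real k * h" using h(1) by (simp add: field_simps)
    then have "AE \<omega> in M. nn_cond_exp M (F r) (\<lambda>\<omega>. ennreal (exp (l * max_osc r \<tau> \<omega>))) \<omega>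
      \<le> ennreal ((1 / (1 - l * (10 * ?\<rho>))) ^ Suc k)"
      using True h r by (intro nn_cond_exp_exp_max_osc_le[where r = r and h = h]) (auto simp: field_simps)
    then show "AE \<omega> in M. nn_cond_exp M (F r) (\<lambda>\<omega>. ennreal (exp (l * max_osc r \<tau> \<omega>))) \<omega> < \<infinity>"
      by eventually_elim (auto intro: le_less_trans)
  next
    case False
    \<comment> \<open>For \<open>l \<le> 0\<close> the exponential is at most \<open>1\<close>,
      whatever the value of \<open>osc_kappa\<close>.\<close>
    have "AE \<omega> in M. nn_cond_exp M (F r) (\<lambda>\<omega>. ennreal (exp (l * max_osc r \<tau> \<omega>))) \<omega> \<le> 1"
    proof (rule nn_cond_exp_F_leI)
      fix A assume A: "A \<in> sets (F r)"
      have "(\<integral>\<^sup>+\<omega>\<in>A. ennreal (exp (l * max_osc r \<tau> \<omega>)) \<partial>M) \<le> (\<integral>\<^sup>+\<omega>. indicator A \<omega> \<partial>M)"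
      proof (rule nn_integral_mono)
        fix \<omega> assume "\<omega> \<in> space M"
        then have "l * max_osc r \<tau> \<omega> \<le> 0"
          using max_osc_nonneg[OF r order_refl] False by (simp add: mult_nonpos_nonneg)
        then show "ennreal (exp (l * max_osc r \<tau> \<omega>)) * indicator A \<omega> \<le> indicator A \<omega>"
          by (auto simp: indicator_def)
      qed
      moreover have "A \<in> sets M" using A sets_F_subset by auto
      ultimately show "(\<integral>\<^sup>+\<omega>\<in>A. ennreal (exp (l * max_osc r \<tau> \<omega>)) \<partial>M) \<le> 1 * emeasure M A"
        by simp
    qed simp_all
    then show "AE \<omega> in M. nn_cond_exp M (F r) (\<lambda>\<omega>. ennreal (exp (l * max_osc r \<tau> \<omega>))) \<omega> < \<infinity>"
      by eventually_elim (auto intro: le_less_trans)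
  qed
  ultimately show ?thesis by blast
qed

end
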